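(* Let $G$ be a graph of treewidth $t$ and let $\mathcal H$ be a non-piercing family of subgraphs of $G$. Then $(G,\mathcal H)$ admits a dual support $Q^*$ with $\mathrm{tw}(Q^* )\le 2^{4(t+1)}$.
   Context: All graphs are finite and simple. A subgraph $H$ of a graph $G$ is identified with its vertex set $V(H)$ (subgraphs are taken to be induced), and intersections, differences and containments of subgraphs refer to their vertex sets. A family $\mathcal H$ of subgraphs of $G$ is non-piercing if every $H\in\mathcal H$ induces a connected subgraph of $G$ and, for all $H,H'\in\mathcal H$, the induced subgraph $G[V(H)\setminus V(H')]$ is connected (an empty vertex set is regarded as connected). A dual support for $(G,\mathcal H)$ is a graph $Q^*$ whose vertex set is $\mathcal H$ (one vertex per member) such that for every $v\in V(G)$ the set $\mathcal H_v=\{H\in\mathcal H: v\in V(H)\}$ induces a connected subgraph of $Q^*$. $\mathrm{tw}$ denotes treewidth. *)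

theory Defs
  imports Main
begin

text \<open>A finite simple graph is given by a finite vertex set V and a set E of edges,
  each edge being a 2-element subset of V.\<close>
definition simple_graph :: "'a set \<Rightarrow> 'a set set \<Rightarrow> bool" where
  "simple_graph V E \<longleftrightarrow> finite V \<and> (\<forall>e\<in>E. e \<subseteq> V \<and> card e = 2)"

text \<open>Adjacency inside the induced subgraph on S.\<close>
definition adj_in :: "'a set set \<Rightarrow> 'a set \<Rightarrow> ('a \<times> 'a) set" where
  "adj_in E S = {(x, y). x \<in> S \<and> y \<in> S \<and> {x, y} \<in> E}"

text \<open>S induces a connected subgraph (the empty set counts as connected).\<close>
definition connected_in :: "'a set set \<Rightarrow> 'a set \<Rightarrow> bool" where
  "connected_in E S \<longleftrightarrow> (\<forall>x\<in>S. \<forall>y\<in>S. (x, y) \<in> (adj_in E S)\<^sup>*)"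

text \<open>A cycle: at least three distinct vertices, consecutive ones adjacent, last adjacent to first.\<close>
definition is_cycle :: "'a set set \<Rightarrow> 'a list \<Rightarrow> bool" where
  "is_cycle E xs \<longleftrightarrow> length xs \<ge> 3 \<and> distinct xs \<and>
     (\<forall>i. Suc i < length xs \<longrightarrow> {xs ! i, xs ! Suc i} \<in> E) \<and> {last xs, hd xs} \<in> E"

definition is_tree :: "'n set \<Rightarrow> 'n set set \<Rightarrow> bool" where
  "is_tree N T \<longleftrightarrow> simple_graph N T \<and> N \<noteq> {} \<and> connected_in T N \<and>
     \<not> (\<exists>xs. is_cycle T xs)"

text \<open>Tree decomposition of (V,E) with tree (N,T) (nodes natural numbers) and bags B.\<close>
definition tree_decomposition ::
  "'a set \<Rightarrow> 'a set set \<Rightarrow> nat set \<Rightarrow> nat set set \<Rightarrow> (nat \<Rightarrow> 'a set) \<Rightarrow> bool" where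
  "tree_decomposition V E N T B \<longleftrightarrow> is_tree N T \<and>
     (\<forall>n\<in>N. B n \<subseteq> V) \<and>
     (\<forall>v\<in>V. \<exists>n\<in>N. v \<in> B n) \<and>
     (\<forall>e\<in>E. \<exists>n\<in>N. e \<subseteq> B n) \<and>
     (\<forall>v\<in>V. connected_in T {n\<in>N. v \<in> B n})"

text \<open>Treewidth: least k such that there is a tree decomposition with all bags of size at most k+1.\<close>
definition treewidth :: "'a set \<Rightarrow> 'a set set \<Rightarrow> nat" where
  "treewidth V E = (LEAST k. \<exists>N T B. tree_decomposition V E N T B \<and> (\<forall>n\<in>N. card (B n) \<le> k + 1))"

text \<open>Non-piercing family of (vertex sets of induced) subgraphs.\<close>
definition non_piercing :: "'a set \<Rightarrow> 'a set set \<Rightarrow> 'a set set \<Rightarrow> bool" where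
  "non_piercing V E \<H> \<longleftrightarrow>
     (\<forall>H\<in>\<H>. H \<subseteq> V \<and> connected_in E H) \<and>
     (\<forall>H\<in>\<H>. \<forall>H'\<in>\<H>. connected_in E (H - H'))"

text \<open>Dual support: a graph with vertex set the family such that for every v the members
  containing v induce a connected subgraph.\<close>
definition dual_support :: "'a set \<Rightarrow> 'a set set \<Rightarrow> 'a set set set \<Rightarrow> bool" where
  "dual_support V \<H> Q \<longleftrightarrow> simple_graph \<H> Q \<and>
     (\<forall>v\<in>V. connected_in Q {H\<in>\<H>. v \<in> H})"

end

theory Submission
  imports Defs
begin

text \<open>
  Discarding non-maximal members (each is attached to a member containing it), the family may be
  taken to be an antichain. Complete the bags of the tree decomposition to cliques and split along
  a tree edge at the root, with separator \<open>A\<close> and sides \<open>V1\<close>, \<open>V2\<close>. If \<open>H \<inter> A \<subseteq> H'\<close>, then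
  \<open>H - H'\<close> is connected and misses \<open>A\<close>, so it lies on one side. Hence two members with equal
  trace on \<open>A\<close> and incomparable restrictions to \<open>V1\<close> agree on \<open>V2\<close>. By induction the maximal
  restrictions to each side have supports, each with a root bag containing one representative per
  trace on the root bag of that side. Lift these supports to the family and join them through one
  bag \<open>W\<close> consisting of all representatives. Any remaining member is covered on \<open>V1\<close> by one
  element of \<open>W\<close> and on \<open>V2\<close> by another, so it can hang off \<open>W\<close>.

  For the induction, connectivity is needed for the members containing any given nonempty clique,
  not only a vertex: members lifted from \<open>V2\<close> that contain a vertex of \<open>V1\<close> are linked through
  the members containing their trace on \<open>A\<close>. All bags have at most \<open>2 ^ (t + 2) + 1\<close> elements.
\<close>

section \<open>Connectivity of induced subgraphs\<close>

text \<open>The edge set of the complete graph on \<open>X\<close>. Thus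
  \<open>pairs X \<subseteq> E\<close> says that \<open>X\<close> is a clique, which holds trivially
  for at most one vertex.\<close>

definition pairs :: "'a set \<Rightarrow> 'a set set" where
  "pairs X = {e. e \<subseteq> X \<and> card e = 2}"

lemma pair_in_pairs: "{x, y} \<in> pairs X \<longleftrightarrow> x \<in> X \<and> y \<in> X \<and> x \<noteq> y"
  by (auto simp: pairs_def card_insert_if)

lemma pairs_mono: "X \<subseteq> Y \<Longrightarrow> pairs X \<subseteq> pairs Y"
  by (auto simp: pairs_def)

lemma in_pairsE:
  assumes "e \<in> pairs X"
  obtains x y where "e = {x, y}" "x \<in> X" "y \<in> X" "x \<noteq> y"
  using assms by (auto simp: pairs_def card_2_iff)

lemma pairs_subset_iff:
  "pairs X \<subseteq> E \<longleftrightarrow> (\<forall>x\<in>X. \<forall>y\<in>X. x \<noteq> y \<longrightarrow> {x, y} \<in> E)"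
proof
  assume "pairs X \<subseteq> E"
  then show "\<forall>x\<in>X. \<forall>y\<in>X. x \<noteq> y \<longrightarrow> {x, y} \<in> E"
    by (meson pair_in_pairs subsetD)
next
  assume "\<forall>x\<in>X. \<forall>y\<in>X. x \<noteq> y \<longrightarrow> {x, y} \<in> E"
  then show "pairs X \<subseteq> E"
    by (auto elim!: in_pairsE)
qed

lemma sym_adj_in: "sym (adj_in E S)"
  by (auto simp: sym_def adj_in_def insert_commute)

lemma rtrancl_adj_in_sym: "(x, y) \<in> (adj_in E S)\<^sup>* \<Longrightarrow> (y, x) \<in> (adj_in E S)\<^sup>*"
  by (metis symD sym_rtrancl sym_adj_in)

lemma rtrancl_adj_in_mono:
  assumes "(x, y) \<in> (adj_in E S)\<^sup>*" "E \<subseteq> E'" "S \<subseteq> S'"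
  shows "(x, y) \<in> (adj_in E' S')\<^sup>*"
proof -
  have "adj_in E S \<subseteq> adj_in E' S'"
    using assms(2,3) by (auto simp: adj_in_def)
  then show ?thesis
    using assms(1) rtrancl_mono by blast
qed

lemma connected_in_mono: "connected_in E S \<Longrightarrow> E \<subseteq> E' \<Longrightarrow> connected_in E' S"
  unfolding connected_in_def by (meson rtrancl_adj_in_mono order_refl)

lemma connected_in_clique:
  assumes "pairs S \<subseteq> E"
  shows "connected_in E S"
  unfolding connected_in_def
proof (intro ballI)
  fix x y
  assume "x \<in> S" "y \<in> S"
  then show "(x, y) \<in> (adj_in E S)\<^sup>*"
    using assms by (cases "x = y") (auto simp: adj_in_def pairs_subset_iff)
qed

lemma connected_in_attach:
  assumes C: "connected_in E C" "C \<subseteq> S"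
    and att: "\<And>x. x \<in> S \<Longrightarrow> \<exists>c\<in>C. (x, c) \<in> (adj_in E S)\<^sup>*"
  shows "connected_in E S"
  unfolding connected_in_def
proof (intro ballI)
  fix x y
  assume "x \<in> S" "y \<in> S"
  then obtain c d where "c \<in> C" "(x, c) \<in> (adj_in E S)\<^sup>*"
    and "d \<in> C" "(y, d) \<in> (adj_in E S)\<^sup>*"
    using att by meson
  moreover have "(c, d) \<in> (adj_in E S)\<^sup>*"
    using C \<open>c \<in> C\<close> \<open>d \<in> C\<close> rtrancl_adj_in_mono[of c d E C E S]
    by (simp add: connected_in_def)
  ultimately show "(x, y) \<in> (adj_in E S)\<^sup>*"
    by (meson rtrancl_adj_in_sym rtrancl_trans)
qed

lemma connected_in_insert:
  assumes "connected_in E S" "p \<in> S" "{l, p} \<in> E"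
  shows "connected_in E (insert l S)"
proof (rule connected_in_attach[OF assms(1)])
  fix x
  assume "x \<in> insert l S"
  then show "\<exists>c\<in>S. (x, c) \<in> (adj_in E (insert l S))\<^sup>*"
  proof
    assume "x = l"
    then have "(x, p) \<in> adj_in E (insert l S)"
      using assms by (auto simp: adj_in_def)
    then show ?thesis
      using assms(2) by blast
  qed blast
qed blast

text \<open>An edge collapsed by \<open>f\<close> turns into a singleton, which
  \<open>adj_in\<close> reads as a loop; walks therefore map to walks for every
  \<open>f\<close>.\<close>

lemma connected_in_image:
  assumes "connected_in E S"
  shows "connected_in ((`) f ` E) (f ` S)"
proof -
  have "(f x, f y) \<in> (adj_in ((`) f ` E) (f ` S))\<^sup>*" if "(x, y) \<in> (adj_in E S)\<^sup>*" for x y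
    using that
  proof (induction rule: rtrancl_induct)
    case (step y z)
    have "f ` {y, z} \<in> (`) f ` E"
      using step.hyps(2) by (intro imageI) (auto simp: adj_in_def)
    then have "(f y, f z) \<in> adj_in ((`) f ` E) (f ` S)"
      using step.hyps(2) by (auto simp: adj_in_def)
    with step.IH show ?case
      by simp
  qed simp
  then show ?thesis
    using assms by (auto simp: connected_in_def)
qed

text \<open>A walk leaves \<open>V1\<close> and returns to it only through
  \<open>V1 \<inter> V2\<close>. As this separator is a clique of \<open>E1\<close>, each excursion
  can be short-cut inside \<open>V1\<close>. This passes the connectivity conditions on a family to
  its restrictions.\<close>

lemma connected_in_restrict:
  assumes con: "connected_in (E1 \<union> E2) P"
    and E: "E1 \<subseteq> pairs V1" "E2 \<subseteq> pairs V2" "pairs (V1 \<inter> V2) \<subseteq> E1"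
  shows "connected_in E1 (P \<inter> V1)"
  unfolding connected_in_def
proof (intro ballI)
  fix x y
  assume x: "x \<in> P \<inter> V1" and y: "y \<in> P \<inter> V1"
  let ?R = "(adj_in E1 (P \<inter> V1))\<^sup>*"
  \<comment> \<open>While the walk is outside \<open>V1\<close>, the invariant remembers a separator
    vertex of \<open>P\<close> already reached inside \<open>V1\<close>; on re-entry the walk
    continues from there.\<close>
  have "(z \<in> V1 \<longrightarrow> (x, z) \<in> ?R) \<and>
      (z \<notin> V1 \<longrightarrow> (\<exists>a\<in>P \<inter> (V1 \<inter> V2). (x, a) \<in> ?R))"
    if "(x, z) \<in> (adj_in (E1 \<union> E2) P)\<^sup>*" for z
    using that
  proof (induction rule: rtrancl_induct)
    case (step z w)
    have zw: "z \<in> P" "w \<in> P" "{z, w} \<in> E1 \<or> {z, w} \<in> E2"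
      using step.hyps(2) by (auto simp: adj_in_def)
    have in1: "{z, w} \<in> E1 \<Longrightarrow> z \<in> V1 \<and> w \<in> V1"
      and in2: "{z, w} \<in> E2 \<Longrightarrow> z \<in> V2 \<and> w \<in> V2 \<and> z \<noteq> w"
      using E(1,2) by (metis pair_in_pairs subsetD)+
    have clique: "(a, b) \<in> ?R" if "a \<in> P \<inter> (V1 \<inter> V2)" "b \<in> P \<inter> (V1 \<inter> V2)" for a b
      using that E(3) by (cases "a = b") (auto simp: adj_in_def pairs_subset_iff)
    consider "z \<in> V1" "w \<in> V1" | "z \<in> V1" "w \<notin> V1" | "z \<notin> V1" "w \<in> V1" | "z \<notin> V1" "w \<notin> V1"
      by blast
    then show ?case
    proof cases
      case 1
      then have "(z, w) \<in> ?R"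
        using zw in2 clique[of z w] by (auto simp: adj_in_def)
      with 1 step.IH show ?thesis
        by (meson rtrancl_trans)
    next
      case 2
      then show ?thesis
        using zw in1 in2 step.IH by blast
    next
      case 3
      then obtain a where "a \<in> P \<inter> (V1 \<inter> V2)" "(x, a) \<in> ?R"
        using step.IH by blast
      moreover have "w \<in> P \<inter> (V1 \<inter> V2)"
        using 3 zw in1 in2 by blast
      ultimately show ?thesis
        using 3 clique by (meson rtrancl_trans)
    next
      case 4
      then show ?thesis
        using step.IH by blast
    qed
  qed (use x in auto)
  then show "(x, y) \<in> ?R"
    using con x y by (auto simp: connected_in_def)
qed

text \<open>Every edge lies within one side, so a walk can change sides only at a separator vertex,
  and \<open>P\<close> has none.\<close>

lemma connected_in_one_side:
  assumes con: "connected_in (E1 \<union> E2) P" and P: "P \<subseteq> V1 \<union> V2" "P \<inter> (V1 \<inter> V2) = {}"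
    and E: "E1 \<subseteq> pairs V1" "E2 \<subseteq> pairs V2"
  shows "P \<subseteq> V1 \<or> P \<subseteq> V2"
proof (cases "P \<inter> V1 = {}")
  case False
  then obtain x where x: "x \<in> P" "x \<in> V1"
    by blast
  have "z \<in> V1" if "(x, z) \<in> (adj_in (E1 \<union> E2) P)\<^sup>*" for z
    using that
  proof (induction rule: rtrancl_induct)
    case (step z w)
    then show ?case
      using E P(2) pair_in_pairs[of z w V1] pair_in_pairs[of z w V2]
      by (auto simp: adj_in_def)
  qed (use x in auto)
  then show ?thesis
    using con x by (auto simp: connected_in_def)
qed (use P in blast)

section \<open>Clique trees\<close>

text \<open>The graph of a tree decomposition with bags of size at most \<open>k\<close> completed
  to cliques; the last argument is the root bag. Rule \<open>glue\<close> adds a tree edge from root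
  \<open>X\<close> to root \<open>Y\<close>, so rule induction cuts at an edge at the root.\<close>

inductive rooted_clique_tree ::
  "nat \<Rightarrow> 'a set \<Rightarrow> 'a set set \<Rightarrow> 'a set \<Rightarrow> bool" for k where
  bag: "finite X \<Longrightarrow> card X \<le> k \<Longrightarrow> rooted_clique_tree k X (pairs X) X"
| glue: "rooted_clique_tree k V1 E1 X \<Longrightarrow> rooted_clique_tree k V2 E2 Y \<Longrightarrow>
    V1 \<inter> V2 \<subseteq> X \<inter> Y \<Longrightarrow> rooted_clique_tree k (V1 \<union> V2) (E1 \<union> E2) X"

text \<open>The same graphs built one leaf bag at a time. This form matches adding and removing
  leaves of a tree, and it is converted to and from the rooted form below.\<close>

inductive clique_tree :: "nat \<Rightarrow> 'a set \<Rightarrow> 'a set set \<Rightarrow> bool" for k where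
  bag: "finite X \<Longrightarrow> card X \<le> k \<Longrightarrow> clique_tree k X (pairs X)"
| add_bag: "clique_tree k V E \<Longrightarrow> finite Y \<Longrightarrow> card Y \<le> k \<Longrightarrow> pairs (V \<inter> Y) \<subseteq> E \<Longrightarrow>
    clique_tree k (V \<union> Y) (E \<union> pairs Y)"

lemma rooted_clique_tree_basic:
  assumes "rooted_clique_tree k V E X"
  shows "finite V \<and> X \<subseteq> V \<and> E \<subseteq> pairs V \<and> pairs X \<subseteq> E \<and> card X \<le> k"
  using assms
proof induction
  case (glue V1 E1 X V2 E2 Y)
  then show ?case
    using pairs_mono[of V1 "V1 \<union> V2"] pairs_mono[of V2 "V1 \<union> V2"] by auto
qed auto

lemma clique_tree_basic:
  assumes "clique_tree k V E"
  shows "finite V \<and> E \<subseteq> pairs V"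
  using assms
proof induction
  case (add_bag V E Y)
  then show ?case
    using pairs_mono[of V "V \<union> Y"] pairs_mono[of Y "V \<union> Y"] by auto
qed auto

text \<open>Vertices strictly on opposite sides are never adjacent, so a clique stays on one side.
  Its edges belong to that side's edge set, because an edge coming from the other side joins two
  separator vertices and the separator is a clique in both.\<close>

lemma clique_in_glued_graph:
  assumes S: "S \<subseteq> V1 \<union> V2" "pairs S \<subseteq> E1 \<union> E2"
    and E: "E1 \<subseteq> pairs V1" "E2 \<subseteq> pairs V2"
      "pairs (V1 \<inter> V2) \<subseteq> E1" "pairs (V1 \<inter> V2) \<subseteq> E2"
  shows "(S \<subseteq> V1 \<and> pairs S \<subseteq> E1) \<or> (S \<subseteq> V2 \<and> pairs S \<subseteq> E2)"
proof -
  have "S \<subseteq> V1 \<or> S \<subseteq> V2"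
  proof (rule ccontr)
    assume "\<not> ?thesis"
    then obtain a b where ab: "a \<in> S" "b \<in> S" "a \<notin> V1" "b \<notin> V2"
      by blast
    then have "a \<noteq> b"
      using S(1) by blast
    then have "{a, b} \<in> E1 \<union> E2"
      using S(2) ab pairs_subset_iff by metis
    then show False
      using E(1,2) ab by (metis UnE pair_in_pairs subsetD)
  qed
  moreover have "{a, b} \<in> E1" if "S \<subseteq> V1" "a \<in> S" "b \<in> S" "a \<noteq> b" for a b
  proof -
    have "{a, b} \<in> E1 \<union> E2"
      using S(2) that pairs_subset_iff by metis
    moreover have "{a, b} \<in> E2 \<Longrightarrow> {a, b} \<in> pairs (V1 \<inter> V2)"
      using E(2) that by (metis IntI pair_in_pairs subsetD)
    ultimately show ?thesis
      using E(3) by blast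
  qed
  moreover have "{a, b} \<in> E2" if "S \<subseteq> V2" "a \<in> S" "b \<in> S" "a \<noteq> b" for a b
  proof -
    have "{a, b} \<in> E1 \<union> E2"
      using S(2) that pairs_subset_iff by metis
    moreover have "{a, b} \<in> E1 \<Longrightarrow> {a, b} \<in> pairs (V1 \<inter> V2)"
      using E(1) that by (metis IntI pair_in_pairs subsetD)
    ultimately show ?thesis
      using E(4) by blast
  qed
  ultimately show ?thesis
    by (auto simp: pairs_subset_iff)
qed

lemma pairs_image:
  assumes "inj_on f X"
  shows "pairs (f ` X) = (`) f ` pairs X"
proof (rule set_eqI)
  fix e
  have "card (f ` d) = card d" if "d \<subseteq> X" for d
    using assms that by (meson card_image inj_on_subset)
  then show "e \<in> pairs (f ` X) \<longleftrightarrow> e \<in> (`) f ` pairs X"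
    by (auto simp: pairs_def subset_image_iff)
qed

lemma rooted_clique_tree_image:
  assumes "rooted_clique_tree k V E X" "inj_on f V"
  shows "rooted_clique_tree k (f ` V) ((`) f ` E) (f ` X)"
  using assms
proof induction
  case (bag X)
  then show ?case
    using rooted_clique_tree.bag[of "f ` X" k] by (simp add: pairs_image card_image)
next
  case (glue V1 E1 X V2 E2 Y)
  have "inj_on f V1" "inj_on f V2"
    using glue.prems by (auto simp: inj_on_def)
  moreover have "f ` V1 \<inter> f ` V2 \<subseteq> f ` X \<inter> f ` Y"
  proof -
    have "f ` V1 \<inter> f ` V2 = f ` (V1 \<inter> V2)"
      using glue.prems by (simp add: inj_on_image_Int)
    then show ?thesis
      using glue.hyps(3) by blast
  qed
  ultimately have "rooted_clique_tree k (f ` V1 \<union> f ` V2) ((`) f ` E1 \<union> (`) f ` E2) (f ` X)"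
    using glue.IH by (intro rooted_clique_tree.glue[where Y = "f ` Y"])
  then show ?case
    by (simp add: image_Un)
qed

text \<open>The second tree may be attached along any clique, not only inside the root bag: by
  \<open>clique_in_glued_graph\<close> that clique lies in one of the two subtrees, and recursion
  descends to a single bag.\<close>

lemma rooted_clique_tree_attach:
  assumes "rooted_clique_tree k V E X" "rooted_clique_tree k V' E' Y"
    and "V \<inter> V' \<subseteq> Y" "pairs (V \<inter> V') \<subseteq> E"
  shows "rooted_clique_tree k (V \<union> V') (E \<union> E') X"
  using assms
proof (induction)
  case (bag X)
  then show ?case
    using rooted_clique_tree.glue[OF rooted_clique_tree.bag[OF bag.hyps] bag.prems(1)] by simp
next
  case (glue V1 E1 X V2 E2 Z)
  have b1: "finite V1 \<and> X \<subseteq> V1 \<and> E1 \<subseteq> pairs V1 \<and> pairs X \<subseteq> E1 \<and> card X \<le> k"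
    and b2: "finite V2 \<and> Z \<subseteq> V2 \<and> E2 \<subseteq> pairs V2 \<and> pairs Z \<subseteq> E2 \<and> card Z \<le> k"
    using glue.hyps rooted_clique_tree_basic by blast+
  have "pairs (V1 \<inter> V2) \<subseteq> E1" "pairs (V1 \<inter> V2) \<subseteq> E2"
    using glue.hyps(3) b1 b2 pairs_mono[of "V1 \<inter> V2" X] pairs_mono[of "V1 \<inter> V2" Z] by auto
  then have "((V1 \<union> V2) \<inter> V' \<subseteq> V1 \<and> pairs ((V1 \<union> V2) \<inter> V') \<subseteq> E1) \<or>
      ((V1 \<union> V2) \<inter> V' \<subseteq> V2 \<and> pairs ((V1 \<union> V2) \<inter> V') \<subseteq> E2)"
    using clique_in_glued_graph[of "(V1 \<union> V2) \<inter> V'" V1 V2 E1 E2] glue.prems b1 b2 by blast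
  then show ?case
  proof
    assume *: "(V1 \<union> V2) \<inter> V' \<subseteq> V1 \<and> pairs ((V1 \<union> V2) \<inter> V') \<subseteq> E1"
    then have "pairs (V1 \<inter> V') \<subseteq> E1"
      using pairs_mono[of "V1 \<inter> V'" "(V1 \<union> V2) \<inter> V'"] by blast
    then have "rooted_clique_tree k (V1 \<union> V') (E1 \<union> E') X"
      using glue.IH(1) glue.prems by blast
    then have "rooted_clique_tree k ((V1 \<union> V') \<union> V2) ((E1 \<union> E') \<union> E2) X"
    proof (rule rooted_clique_tree.glue[OF _ glue.hyps(2)])
      \<comment> \<open>Since \<open>V'\<close> meets \<open>V2\<close> only inside
        \<open>V1\<close>, enlarging \<open>V1\<close> leaves the old separator unchanged.\<close>
      show "(V1 \<union> V') \<inter> V2 \<subseteq> X \<inter> Z"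
        using glue.hyps(3) * by blast
    qed
    then show ?thesis
      by (simp add: Un_ac)
  next
    assume *: "(V1 \<union> V2) \<inter> V' \<subseteq> V2 \<and> pairs ((V1 \<union> V2) \<inter> V') \<subseteq> E2"
    then have "pairs (V2 \<inter> V') \<subseteq> E2"
      using pairs_mono[of "V2 \<inter> V'" "(V1 \<union> V2) \<inter> V'"] by blast
    then have "rooted_clique_tree k (V2 \<union> V') (E2 \<union> E') Z"
      using glue.IH(2) glue.prems by blast
    then have "rooted_clique_tree k (V1 \<union> (V2 \<union> V')) (E1 \<union> (E2 \<union> E')) X"
    proof (rule rooted_clique_tree.glue[OF glue.hyps(1)])
      show "V1 \<inter> (V2 \<union> V') \<subseteq> X \<inter> Z"
        using glue.hyps(3) * by blast
    qed
    then show ?thesis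
      by (simp add: Un_ac)
  qed
qed

lemma clique_tree_imp_rooted:
  assumes "clique_tree k V E"
  shows "\<exists>X. rooted_clique_tree k V E X"
  using assms
proof induction
  case (bag X)
  then show ?case
    using rooted_clique_tree.bag by blast
next
  case (add_bag V E Y)
  then show ?case
    using rooted_clique_tree_attach[OF _ rooted_clique_tree.bag, of k V E _ Y] by blast
qed

text \<open>The bags of the rooted tree are added from the root outwards: the part with root
  \<open>X\<close> comes first, and \<open>V2\<close> then meets everything built so far only inside
  \<open>X \<inter> Z\<close>.\<close>

lemma clique_tree_attach_rooted:
  assumes "rooted_clique_tree k V' E' Y" "clique_tree k V E"
    and "V \<inter> V' \<subseteq> Y" "pairs (V \<inter> V') \<subseteq> E"
  shows "clique_tree k (V \<union> V') (E \<union> E')"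
  using assms
proof (induction arbitrary: V E)
  case (bag X)
  then show ?case
    using clique_tree.add_bag by blast
next
  case (glue V1 E1 X V2 E2 Z)
  have b1: "X \<subseteq> V1" "pairs X \<subseteq> E1"
    using glue.hyps rooted_clique_tree_basic by blast+
  have "pairs (V \<inter> V1) \<subseteq> E"
    using glue.prems(3) pairs_mono[of "V \<inter> V1" "V \<inter> (V1 \<union> V2)"] by blast
  then have 1: "clique_tree k (V \<union> V1) (E \<union> E1)"
    using glue.IH(1)[of V E] glue.prems by blast
  have "(V \<union> V1) \<inter> V2 \<subseteq> X \<inter> Z"
    using glue.prems(2) b1 glue.hyps(3) by blast
  moreover from this have "pairs ((V \<union> V1) \<inter> V2) \<subseteq> E \<union> E1"
    using pairs_mono[of "(V \<union> V1) \<inter> V2" X] b1 by blast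
  ultimately have "clique_tree k ((V \<union> V1) \<union> V2) ((E \<union> E1) \<union> E2)"
    using glue.IH(2)[OF 1] by blast
  then show ?case
    by (simp add: Un_ac)
qed

lemma rooted_imp_clique_tree:
  assumes "rooted_clique_tree k V E X"
  shows "clique_tree k V E"
proof -
  have b: "finite V \<and> X \<subseteq> V \<and> E \<subseteq> pairs V \<and> pairs X \<subseteq> E \<and> card X \<le> k"
    using assms rooted_clique_tree_basic by blast
  have "clique_tree k X (pairs X)"
    using b finite_subset clique_tree.bag by metis
  then have "clique_tree k (X \<union> V) (pairs X \<union> E)"
    using clique_tree_attach_rooted[OF assms, of X "pairs X"] pairs_mono[of "X \<inter> V" X] by blast
  then show ?thesis
    using b by (metis Un_absorb1)
qed

text \<open>Each new vertex \<open>H\<close> gets its own bag \<open>insert H W\<close> below the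
  root; the strict bound on \<open>card W\<close> leaves room for it.\<close>

lemma rooted_clique_tree_add_leaves:
  assumes "finite L" "rooted_clique_tree k V E W" "L \<inter> V = {}" "card W < k"
  shows "rooted_clique_tree k (V \<union> L) (E \<union> (\<Union>H\<in>L. pairs (insert H W))) W"
  using assms
proof (induction L)
  case (insert H L)
  have b: "finite W" "W \<subseteq> V"
    using insert.prems rooted_clique_tree_basic finite_subset by metis+
  have "card (insert H W) \<le> k"
    using b insert.prems by (simp add: card_insert_if)
  then have "rooted_clique_tree k (insert H W) (pairs (insert H W)) (insert H W)"
    using b rooted_clique_tree.bag[of "insert H W"] by blast
  moreover have "rooted_clique_tree k (V \<union> L) (E \<union> (\<Union>H\<in>L. pairs (insert H W))) W"
    using insert by blast
  moreover have "(V \<union> L) \<inter> insert H W \<subseteq> W \<inter> insert H W"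
    using insert by blast
  ultimately have "rooted_clique_tree k ((V \<union> L) \<union> insert H W)
      ((E \<union> (\<Union>H\<in>L. pairs (insert H W))) \<union> pairs (insert H W)) W"
    using rooted_clique_tree.glue by blast
  moreover have "(V \<union> L) \<union> insert H W = V \<union> insert H L"
    using b by blast
  moreover have "(E \<union> (\<Union>H\<in>L. pairs (insert H W))) \<union> pairs (insert H W) =
      E \<union> (\<Union>H\<in>insert H L. pairs (insert H W))"
    by blast
  ultimately show ?case
    by simp
qed simp

section \<open>Splitting an antichain along a clique separator\<close>

definition maximal_sets :: "'a set set \<Rightarrow> 'a set set" where
  "maximal_sets F = {P \<in> F. \<forall>P'\<in>F. P \<subseteq> P' \<longrightarrow> P' = P}"

lemma maximal_sets_above:
  assumes "finite F" "P \<in> F"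
  shows "\<exists>P'\<in>maximal_sets F. P \<subseteq> P'"
  using finite_has_maximal2[OF assms] by (auto simp: maximal_sets_def)

lemma maximal_sets_antichain:
  "P \<in> maximal_sets F \<Longrightarrow> P' \<in> maximal_sets F \<Longrightarrow> P \<subseteq> P' \<Longrightarrow> P = P'"
  by (auto simp: maximal_sets_def)

text \<open>The separator is \<open>V1 \<inter> V2\<close>. The functions \<open>f1\<close>, \<open>f2\<close> lift maximal restrictions back to
  members of the family, and \<open>X1\<close>, \<open>X2\<close> realise all separator traces. The preference conditions
  make every member lifted from both sides lie over both \<open>X1\<close> and \<open>X2\<close>, so that it occupies
  a connected part of the combined clique tree.\<close>

locale split_family =
  fixes V1 V2 :: "'a set" and F :: "'a set set"
    and f1 f2 :: "'a set \<Rightarrow> 'a set" and X1 X2 :: "'a set set"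
  assumes finite_F: "finite F"
    and antichain: "H \<in> F \<Longrightarrow> H' \<in> F \<Longrightarrow> H \<subseteq> H' \<Longrightarrow> H = H'"
    and covered: "H \<in> F \<Longrightarrow> H \<subseteq> V1 \<union> V2"
    and diff_one_sided: "H \<in> F \<Longrightarrow> H' \<in> F \<Longrightarrow> H \<inter> (V1 \<inter> V2) \<subseteq> H' \<Longrightarrow>
          H \<inter> V1 \<subseteq> H' \<or> H \<inter> V2 \<subseteq> H'"
    and one_sided: "H \<in> F \<Longrightarrow> H \<inter> (V1 \<inter> V2) = {} \<Longrightarrow> H \<inter> V1 = {} \<or> H \<inter> V2 = {}"
    and f1: "P \<in> maximal_sets ((\<lambda>H. H \<inter> V1) ` F) \<Longrightarrow> f1 P \<in> F \<and> f1 P \<inter> V1 = P"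
    and f2: "P \<in> maximal_sets ((\<lambda>H. H \<inter> V2) ` F) \<Longrightarrow> f2 P \<in> F \<and> f2 P \<inter> V2 = P"
    and pref1: "P \<in> maximal_sets ((\<lambda>H. H \<inter> V1) ` F) \<Longrightarrow> H \<in> F \<Longrightarrow> H \<inter> V1 = P \<Longrightarrow>
          H \<inter> V2 \<in> X2 \<Longrightarrow> f1 P \<inter> V2 \<in> X2"
    and pref2: "P \<in> maximal_sets ((\<lambda>H. H \<inter> V2) ` F) \<Longrightarrow> H \<in> F \<Longrightarrow> H \<inter> V2 = P \<Longrightarrow>
          H \<inter> V1 \<in> X1 \<Longrightarrow> f2 P \<inter> V1 \<in> X1"
    and X1: "X1 \<subseteq> maximal_sets ((\<lambda>H. H \<inter> V1) ` F)"
    and X2: "X2 \<subseteq> maximal_sets ((\<lambda>H. H \<inter> V2) ` F)"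
    and trace1: "P \<in> maximal_sets ((\<lambda>H. H \<inter> V1) ` F) \<Longrightarrow>
          \<exists>Z\<in>X1. Z \<inter> (V1 \<inter> V2) = P \<inter> (V1 \<inter> V2)"
    and trace2: "P \<in> maximal_sets ((\<lambda>H. H \<inter> V2) ` F) \<Longrightarrow>
          \<exists>Z\<in>X2. Z \<inter> (V1 \<inter> V2) = P \<inter> (V1 \<inter> V2)"
begin

abbreviation "F1 \<equiv> maximal_sets ((\<lambda>H. H \<inter> V1) ` F)"
abbreviation "F2 \<equiv> maximal_sets ((\<lambda>H. H \<inter> V2) ` F)"

text \<open>The assumptions are symmetric in the two sides, so each lemma below is proved for side 1
  only and reused with the sides exchanged.\<close>

lemma swapped: "split_family V2 V1 F f2 f1 X2 X1"
proof unfold_locales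
  show "H \<subseteq> V2 \<union> V1" if "H \<in> F" for H
    using covered[OF that] by blast
  show "H \<inter> V2 \<subseteq> H' \<or> H \<inter> V1 \<subseteq> H'" if "H \<in> F" "H' \<in> F" "H \<inter> (V2 \<inter> V1) \<subseteq> H'" for H H'
    using diff_one_sided[of H H'] that by (auto simp: Int_commute)
  show "H \<inter> V2 = {} \<or> H \<inter> V1 = {}" if "H \<in> F" "H \<inter> (V2 \<inter> V1) = {}" for H
    using one_sided[of H] that by (auto simp: Int_commute)
  show "\<exists>Z\<in>X2. Z \<inter> (V2 \<inter> V1) = P \<inter> (V2 \<inter> V1)" if "P \<in> F2" for P
    using trace2[OF that] by (simp add: Int_commute)
  show "\<exists>Z\<in>X1. Z \<inter> (V2 \<inter> V1) = P \<inter> (V2 \<inter> V1)" if "P \<in> F1" for P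
    using trace1[OF that] by (simp add: Int_commute)
qed (fact finite_F antichain f1 f2 pref1 pref2 X1 X2)+

text \<open>Distinct maximal restrictions are incomparable, so \<open>diff_one_sided\<close>, used
  in both directions, can only hold through its \<open>V2\<close> alternative.\<close>

lemma other_part_eq:
  assumes "H \<in> F" "r \<in> F" "H \<inter> V1 \<in> F1" "r \<inter> V1 \<in> F1" "H \<inter> V1 \<noteq> r \<inter> V1"
    and "H \<inter> (V1 \<inter> V2) = r \<inter> (V1 \<inter> V2)"
  shows "H \<inter> V2 = r \<inter> V2"
proof -
  have "\<not> H \<inter> V1 \<subseteq> r" "\<not> r \<inter> V1 \<subseteq> H"
    using maximal_sets_antichain[of "H \<inter> V1" _ "r \<inter> V1"]
      maximal_sets_antichain[of "r \<inter> V1" _ "H \<inter> V1"] assms(3-5) by blast+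
  then show ?thesis
    using diff_one_sided[of H r] diff_one_sided[of r H] assms by blast
qed

text \<open>This controls the overlap of the two lifted families. The representative
  \<open>f1 Z\<close> with the trace of \<open>H\<close> either has the same restriction to
  \<open>V1\<close> or agrees with \<open>H\<close> on \<open>V2\<close>.\<close>

lemma lifted_twice:
  assumes "H \<in> f1 ` F1" "H \<in> f2 ` F2"
  shows "H \<in> f1 ` X1"
proof -
  obtain P P' where P: "P \<in> F1" "H = f1 P" "H \<in> F" "H \<inter> V1 = P"
    and P': "P' \<in> F2" "H = f2 P'" "H \<inter> V2 = P'"
    using assms f1 f2 by blast
  obtain Z where Z: "Z \<in> X1" "Z \<inter> (V1 \<inter> V2) = P \<inter> (V1 \<inter> V2)"
    using trace1 P by blast
  have r: "f1 Z \<in> F" "f1 Z \<inter> V1 = Z" "Z \<in> F1"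
    using f1 Z X1 by blast+
  have "P \<in> X1"
  proof (cases "Z = P")
    case False
    have "H \<inter> V2 = f1 Z \<inter> V2"
    proof (rule other_part_eq)
      show "H \<inter> (V1 \<inter> V2) = f1 Z \<inter> (V1 \<inter> V2)"
        using Z(2) P(4) r(2) by blast
    qed (use P r False in simp_all)
    \<comment> \<open>Both \<open>f1 Z\<close> and \<open>H = f2 P'\<close> restrict to
      \<open>P'\<close> on \<open>V2\<close>. As \<open>f1 Z\<close> restricts to a member of
      \<open>X1\<close>, the preference built into \<open>f2\<close> forces the same for
      \<open>H\<close>.\<close>
    then show ?thesis
      using pref2[OF P'(1) r(1)] P'(2,3) Z(1) r(2) P(4) by simp
  qed (use Z in simp)
  then show ?thesis
    using P by blast
qed

text \<open>Take a maximal \<open>P\<close> above \<open>H \<inter> V1\<close> and its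
  representative \<open>Z\<close>. If \<open>f1 Z\<close> failed to cover
  \<open>H \<inter> V1\<close>, it would cover \<open>H \<inter> V2\<close> and agree with
  \<open>f1 P\<close> on \<open>V2\<close>. Then \<open>H \<subseteq> f1 P\<close>, and the
  antichain condition would make \<open>H\<close> a lift.\<close>

lemma dominator:
  assumes "H \<in> F" "H \<notin> f1 ` F1"
  shows "\<exists>D\<in>f1 ` X1. H \<inter> V1 \<subseteq> D"
proof -
  obtain P where P: "P \<in> F1" "H \<inter> V1 \<subseteq> P"
    using maximal_sets_above[of "(\<lambda>H. H \<inter> V1) ` F" "H \<inter> V1"] finite_F assms by blast
  obtain Z where Z: "Z \<in> X1" "Z \<inter> (V1 \<inter> V2) = P \<inter> (V1 \<inter> V2)"
    using trace1 P by blast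
  have r: "f1 Z \<in> F" "f1 Z \<inter> V1 = Z" "Z \<in> F1" and p: "f1 P \<in> F" "f1 P \<inter> V1 = P"
    using f1 Z X1 P by blast+
  have "H \<inter> V1 \<subseteq> f1 Z"
  proof (rule ccontr)
    assume no: "\<not> H \<inter> V1 \<subseteq> f1 Z"
    then have "Z \<noteq> P"
      using P p by blast
    then have eq: "f1 P \<inter> V2 = f1 Z \<inter> V2"
    proof (intro other_part_eq)
      show "f1 P \<inter> (V1 \<inter> V2) = f1 Z \<inter> (V1 \<inter> V2)"
        using Z(2) p(2) r(2) by blast
    qed (use P p r \<open>Z \<noteq> P\<close> in simp_all)
    have "H \<inter> (V1 \<inter> V2) \<subseteq> f1 Z"
      using P Z r by blast
    then have "H \<inter> V2 \<subseteq> f1 Z"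
      using diff_one_sided[OF assms(1) r(1)] no by blast
    then have "H \<subseteq> f1 P"
      using eq P p covered[OF assms(1)] by blast
    then show False
      using antichain[OF assms(1) p(1)] assms(2) P(1) by blast
  qed
  then show ?thesis
    using Z by blast
qed

text \<open>Unless \<open>f1 P\<close> is \<open>H\<close> itself, maximality of
  \<open>H \<inter> V1\<close> excludes the \<open>V1\<close> alternative of
  \<open>diff_one_sided\<close>.\<close>

lemma lifted_above_trace:
  assumes "H \<in> f1 ` F1" "P \<in> F1" "H \<inter> (V1 \<inter> V2) \<subseteq> P"
  shows "H \<inter> V2 \<subseteq> f1 P"
proof -
  have H: "H \<in> F" "H \<inter> V1 \<in> F1" "f1 (H \<inter> V1) = H" and p: "f1 P \<in> F" "f1 P \<inter> V1 = P"
    using assms f1 by auto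
  show ?thesis
  proof (cases "P = H \<inter> V1")
    case False
    then have "\<not> H \<inter> V1 \<subseteq> f1 P"
      using maximal_sets_antichain[OF H(2) assms(2)] p by blast
    moreover have "H \<inter> (V1 \<inter> V2) \<subseteq> f1 P"
      using assms p by blast
    ultimately show ?thesis
      using diff_one_sided[OF H(1) p(1)] by blast
  qed (use H in auto)
qed

lemma lifted_representative:
  assumes "H \<in> f1 ` F1"
  shows "\<exists>r\<in>f1 ` X1. r \<inter> (V1 \<inter> V2) = H \<inter> (V1 \<inter> V2) \<and> (r = H \<or> r \<inter> V2 = H \<inter> V2)"
proof -
  have H: "H \<in> F" "H \<inter> V1 \<in> F1" "f1 (H \<inter> V1) = H"
    using assms f1 by auto
  obtain Z where Z: "Z \<in> X1" "Z \<inter> (V1 \<inter> V2) = (H \<inter> V1) \<inter> (V1 \<inter> V2)"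
    using trace1 H by blast
  have r: "f1 Z \<in> F" "f1 Z \<inter> V1 = Z" "Z \<in> F1"
    using f1 Z X1 by blast+
  have tr: "f1 Z \<inter> (V1 \<inter> V2) = H \<inter> (V1 \<inter> V2)"
    using Z r by blast
  have "f1 Z = H \<or> f1 Z \<inter> V2 = H \<inter> V2"
    using other_part_eq[of "f1 Z" H] H r tr by metis
  then show ?thesis
    using tr Z by blast
qed

text \<open>If \<open>H\<close> met \<open>V2\<close>, then \<open>H \<inter> V1\<close> would be
  empty by \<open>one_sided\<close>. An empty maximal restriction is the only one, hence it lies in
  \<open>X1\<close>.\<close>

lemma lifted_empty_trace:
  assumes "H \<in> f1 ` F1" "H \<notin> f1 ` X1" "H \<inter> (V1 \<inter> V2) = {}"
  shows "H \<inter> V2 = {}"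
proof (rule ccontr)
  assume "H \<inter> V2 \<noteq> {}"
  have H: "H \<in> F" "H \<inter> V1 \<in> F1" "f1 (H \<inter> V1) = H"
    using assms f1 by auto
  then have "H \<inter> V1 = {}"
    using one_sided[OF H(1) assms(3)] \<open>H \<inter> V2 \<noteq> {}\<close> by blast
  moreover obtain Z where "Z \<in> X1"
    using trace1 H by blast
  ultimately have "H \<inter> V1 = Z"
    using maximal_sets_antichain[OF H(2), of Z] X1 by blast
  then show False
    using \<open>Z \<in> X1\<close> H assms(2) by blast
qed

text \<open>The core \<open>?C\<close> of members lifted from side 1 is connected by
  \<open>con1\<close>. Every other member above \<open>S\<close> reaches it, either by one edge to a
  dominator or first through members lifted from side 2.\<close>

lemma above_clique_connected:
  assumes Q: "(`) f1 ` Q1 \<subseteq> Q" "(`) f2 ` Q2 \<subseteq> Q" "pairs W \<subseteq> Q"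
      "\<And>H. H \<in> F - (f1 ` F1 \<union> f2 ` F2) \<Longrightarrow> pairs (insert H W) \<subseteq> Q"
    and W: "f1 ` X1 \<subseteq> W" "f2 ` X2 \<subseteq> W"
    and S: "S \<noteq> {}" "S \<subseteq> V1"
    and con1: "connected_in Q1 {P \<in> F1. S \<subseteq> P}"
    and con2: "\<And>A. A \<noteq> {} \<Longrightarrow> A \<subseteq> V1 \<inter> V2 \<Longrightarrow> connected_in Q2 {P \<in> F2. A \<subseteq> P}"
  shows "connected_in Q {H \<in> F. S \<subseteq> H}"
proof -
  interpret swap: split_family V2 V1 F f2 f1 X2 X1
    by (rule swapped)
  let ?FS = "{H \<in> F. S \<subseteq> H}" and ?C = "f1 ` {P \<in> F1. S \<subseteq> P}"
  have C: "?C \<subseteq> ?FS"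
    using f1 by blast
  have in_C: "H \<in> ?C" if "H \<in> f1 ` F1" "S \<subseteq> H" for H
    using that f1 S by blast
  \<comment> \<open>Such an \<open>H\<close>, if not in the core, is adjacent to all other members
    of \<open>W\<close>; its dominator lies in \<open>W\<close> and, since
    \<open>S \<subseteq> V1\<close>, also contains \<open>S\<close>.\<close>
  have near: "\<exists>c\<in>?C. (H, c) \<in> (adj_in Q ?FS)\<^sup>*"
    if H: "H \<in> F" "S \<subseteq> H" "H \<in> W \<or> H \<notin> f2 ` F2" for H
  proof (cases "H \<in> f1 ` F1")
    case True
    then show ?thesis
      using in_C[OF True H(2)] by blast
  next
    case False
    then obtain D where D: "D \<in> f1 ` X1" "H \<inter> V1 \<subseteq> D"
      using dominator[OF H(1) False] by blast
    have SD: "S \<subseteq> D"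
      using D(2) H(2) S(2) by blast
    have DC: "D \<in> ?C"
      by (rule in_C[OF _ SD]) (rule subsetD[OF image_mono[OF X1] D(1)])
    have "pairs (insert H W) \<subseteq> Q"
    proof (cases "H \<in> W")
      case True
      then show ?thesis
        using Q(3) by (simp add: insert_absorb)
    next
      case notW: False
      then show ?thesis
        using Q(4)[of H] H False by blast
    qed
    moreover have "D \<noteq> H" "D \<in> W"
      using False D X1 W by blast+
    ultimately have "{H, D} \<in> Q"
      using pairs_subset_iff[of "insert H W" Q] by blast
    then have "(H, D) \<in> adj_in Q ?FS"
      using H SD DC C by (auto simp: adj_in_def)
    then show ?thesis
      using DC by blast
  qed
  have "\<exists>c\<in>?C. (H, c) \<in> (adj_in Q ?FS)\<^sup>*" if H: "H \<in> F" "S \<subseteq> H" for H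
  proof (cases "H \<in> W \<or> H \<notin> f2 ` F2")
    case True
    then show ?thesis
      using near H by blast
  next
    case False
    \<comment> \<open>Here \<open>H\<close> is lifted from side 2 and lies outside \<open>W\<close>.
      The lifts containing its trace \<open>?A\<close> are connected by \<open>con2\<close>, all
      contain \<open>H \<inter> V1\<close> and so \<open>S\<close>, and include a representative in
      \<open>W\<close>, to which \<open>near\<close> applies.\<close>
    let ?A = "H \<inter> (V1 \<inter> V2)"
    let ?D = "f2 ` {P \<in> F2. ?A \<subseteq> P}"
    have HM: "H \<in> f2 ` F2" "H \<notin> f2 ` X2"
      using False W by auto
    have "?A \<noteq> {}"
      using swap.lifted_empty_trace[OF HM] S H by (auto simp: Int_commute)
    then have "connected_in ((`) f2 ` Q2) ?D"
      using con2[of ?A] by (intro connected_in_image) blast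
    then have con: "connected_in Q ?D"
      using connected_in_mono Q(2) by blast
    have D: "?D \<subseteq> ?FS"
    proof
      fix h
      assume "h \<in> ?D"
      then obtain P where P: "h = f2 P" "P \<in> F2" "?A \<subseteq> P"
        by blast
      then have "H \<inter> V1 \<subseteq> h"
        using swap.lifted_above_trace[OF HM(1), of P] by (simp add: Int_commute)
      then show "h \<in> ?FS"
        using P f2 S H by blast
    qed
    obtain r where r: "r \<in> f2 ` X2" "r \<inter> (V2 \<inter> V1) = H \<inter> (V2 \<inter> V1)"
      using swap.lifted_representative[OF HM(1)] by blast
    have in_D: "h \<in> ?D" if h: "h \<in> f2 ` F2" "?A \<subseteq> h" for h
    proof -
      obtain P where P: "P \<in> F2" "h = f2 P"
        using h(1) by blast
      then have "?A \<subseteq> P"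
        using f2[OF P(1)] h(2) by blast
      then show ?thesis
        using P by blast
    qed
    have "r \<in> ?D" "H \<in> ?D"
      using in_D[of r] in_D[of H] r HM(1) image_mono[OF X2, of f2] by blast+
    then have Hr: "(H, r) \<in> (adj_in Q ?FS)\<^sup>*"
      using con D rtrancl_adj_in_mono[of H r Q ?D Q ?FS] by (auto simp: connected_in_def)
    have "r \<in> F" "S \<subseteq> r" "r \<in> W"
      using subsetD[OF D \<open>r \<in> ?D\<close>] subsetD[OF W(2) r(1)] by simp_all
    then obtain c where "c \<in> ?C" "(r, c) \<in> (adj_in Q ?FS)\<^sup>*"
      using near[of r] by blast
    then show ?thesis
      using Hr by (meson rtrancl_trans)
  qed
  moreover have "connected_in Q ?C"
    using connected_in_mono[OF connected_in_image[OF con1] Q(1)] .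
  ultimately show ?thesis
    using connected_in_attach[OF _ C] by blast
qed

end

section \<open>Dual supports of antichains\<close>

text \<open>The induction invariant. The root bag \<open>Y\<close> has exactly one member per trace
  on \<open>X\<close>, which bounds its size by \<open>2 ^ card X\<close> and lets the next gluing
  find all separator traces in root bags.\<close>

definition antichain_support ::
  "nat \<Rightarrow> 'a set \<Rightarrow> 'a set set \<Rightarrow> 'a set \<Rightarrow> 'a set set \<Rightarrow> 'a set set set \<Rightarrow> 'a set set \<Rightarrow> bool"
  where
  "antichain_support k V E X F Q Y \<longleftrightarrow> rooted_clique_tree k F Q Y \<and>
     inj_on (\<lambda>H. H \<inter> X) Y \<and> (\<forall>H\<in>F. \<exists>H'\<in>Y. H' \<inter> X = H \<inter> X) \<and>
     (\<forall>S. S \<noteq> {} \<longrightarrow> S \<subseteq> V \<longrightarrow> pairs S \<subseteq> E \<longrightarrow> connected_in Q {H \<in> F. S \<subseteq> H})"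

lemma card_traces:
  assumes "inj_on (\<lambda>H. H \<inter> X) Y" "finite X" "card X \<le> n"
  shows "finite Y \<and> card Y \<le> 2 ^ n"
proof -
  have sub: "(\<lambda>H. H \<inter> X) ` Y \<subseteq> Pow X"
    by blast
  have "card Y \<le> card (Pow X)"
    using card_inj_on_le[OF assms(1) sub] assms(2) by simp
  also have "\<dots> \<le> 2 ^ n"
    using assms by (simp add: card_Pow power_increasing)
  finally show ?thesis
    using assms sub by (meson finite_Pow_iff inj_on_finite)
qed

text \<open>In each fibre of \<open>h\<close>, an element satisfying \<open>R\<close> is chosen
  whenever there is one.\<close>

lemma preferred_section:
  assumes "A \<subseteq> h ` F"
  shows "\<exists>f. (\<forall>a\<in>A. f a \<in> F \<and> h (f a) = a) \<and> (\<forall>a\<in>A. \<forall>x\<in>F. h x = a \<longrightarrow> R x \<longrightarrow> R (f a))"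
proof -
  have "\<forall>a\<in>A. \<exists>y. y \<in> F \<and> h y = a \<and> (\<forall>x\<in>F. h x = a \<longrightarrow> R x \<longrightarrow> R y)"
    using assms by blast
  then have "\<exists>f. \<forall>a\<in>A. f a \<in> F \<and> h (f a) = a \<and> (\<forall>x\<in>F. h x = a \<longrightarrow> R x \<longrightarrow> R (f a))"
    by (rule bchoice)
  then show ?thesis
    by (elim ex_forward) blast
qed

lemma antichain_support_glue:
  fixes V1 V2 :: "'a set"
  assumes t1: "rooted_clique_tree n V1 E1 X" and t2: "rooted_clique_tree n V2 E2 Y"
    and sep: "V1 \<inter> V2 \<subseteq> X \<inter> Y"
    and F: "F \<subseteq> Pow (V1 \<union> V2)" "\<And>H. H \<in> F \<Longrightarrow> connected_in (E1 \<union> E2) H"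
      "\<And>H H'. H \<in> F \<Longrightarrow> H' \<in> F \<Longrightarrow> connected_in (E1 \<union> E2) (H - H')"
      "\<And>H H'. H \<in> F \<Longrightarrow> H' \<in> F \<Longrightarrow> H \<subseteq> H' \<Longrightarrow> H = H'"
    and s1: "antichain_support k V1 E1 X (maximal_sets ((\<lambda>H. H \<inter> V1) ` F)) Q1 X1"
    and s2: "antichain_support k V2 E2 Y (maximal_sets ((\<lambda>H. H \<inter> V2) ` F)) Q2 X2"
    and k: "2 ^ (n + 1) < k"
  shows "\<exists>Q Z. antichain_support k (V1 \<union> V2) (E1 \<union> E2) X F Q Z"
proof -

  \<comment> \<open>Lifting the restrictions of both sides\<close>
  have b1: "finite V1" "X \<subseteq> V1" "E1 \<subseteq> pairs V1" "pairs X \<subseteq> E1" "card X \<le> n"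
    and b2: "finite V2" "Y \<subseteq> V2" "E2 \<subseteq> pairs V2" "pairs Y \<subseteq> E2" "card Y \<le> n"
    using t1 t2 rooted_clique_tree_basic by blast+
  have sepE: "pairs (V1 \<inter> V2) \<subseteq> E1" "pairs (V1 \<inter> V2) \<subseteq> E2"
    using sep b1 b2 pairs_mono[of "V1 \<inter> V2" X] pairs_mono[of "V1 \<inter> V2" Y] by auto
  have finXY: "finite X" "finite Y"
    using b1 b2 finite_subset by blast+
  have finF: "finite F"
    using finite_subset[OF F(1)] b1(1) b2(1) by simp
  let ?F1 = "maximal_sets ((\<lambda>H. H \<inter> V1) ` F)" and ?F2 = "maximal_sets ((\<lambda>H. H \<inter> V2) ` F)"
  have a1: "rooted_clique_tree k ?F1 Q1 X1" "inj_on (\<lambda>H. H \<inter> X) X1"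
      "\<forall>H\<in>?F1. \<exists>H'\<in>X1. H' \<inter> X = H \<inter> X"
      "\<forall>S. S \<noteq> {} \<longrightarrow> S \<subseteq> V1 \<longrightarrow> pairs S \<subseteq> E1 \<longrightarrow> connected_in Q1 {H \<in> ?F1. S \<subseteq> H}"
    and a2: "rooted_clique_tree k ?F2 Q2 X2" "inj_on (\<lambda>H. H \<inter> Y) X2"
      "\<forall>H\<in>?F2. \<exists>H'\<in>X2. H' \<inter> Y = H \<inter> Y"
      "\<forall>S. S \<noteq> {} \<longrightarrow> S \<subseteq> V2 \<longrightarrow> pairs S \<subseteq> E2 \<longrightarrow> connected_in Q2 {H \<in> ?F2. S \<subseteq> H}"
    using s1 s2 by (simp_all add: antichain_support_def)
  have X1: "X1 \<subseteq> ?F1" and X2: "X2 \<subseteq> ?F2"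
    using a1(1) a2(1) rooted_clique_tree_basic by blast+

  have "?F1 \<subseteq> (\<lambda>H. H \<inter> V1) ` F"
    by (auto simp: maximal_sets_def)
  from preferred_section[OF this, of "\<lambda>H. H \<inter> V2 \<in> X2"]
  obtain f1 where "(\<forall>P\<in>?F1. f1 P \<in> F \<and> f1 P \<inter> V1 = P) \<and>
      (\<forall>P\<in>?F1. \<forall>H\<in>F. H \<inter> V1 = P \<longrightarrow> H \<inter> V2 \<in> X2 \<longrightarrow> f1 P \<inter> V2 \<in> X2)" ..
  then have f1: "\<And>P. P \<in> ?F1 \<Longrightarrow> f1 P \<in> F \<and> f1 P \<inter> V1 = P"
      "\<And>P H. P \<in> ?F1 \<Longrightarrow> H \<in> F \<Longrightarrow> H \<inter> V1 = P \<Longrightarrow> H \<inter> V2 \<in> X2 \<Longrightarrow> f1 P \<inter> V2 \<in> X2"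
    by blast+
  have "?F2 \<subseteq> (\<lambda>H. H \<inter> V2) ` F"
    by (auto simp: maximal_sets_def)
  from preferred_section[OF this, of "\<lambda>H. H \<inter> V1 \<in> X1"]
  obtain f2 where "(\<forall>P\<in>?F2. f2 P \<in> F \<and> f2 P \<inter> V2 = P) \<and>
      (\<forall>P\<in>?F2. \<forall>H\<in>F. H \<inter> V2 = P \<longrightarrow> H \<inter> V1 \<in> X1 \<longrightarrow> f2 P \<inter> V1 \<in> X1)" ..
  then have f2: "\<And>P. P \<in> ?F2 \<Longrightarrow> f2 P \<in> F \<and> f2 P \<inter> V2 = P"
      "\<And>P H. P \<in> ?F2 \<Longrightarrow> H \<in> F \<Longrightarrow> H \<inter> V2 = P \<Longrightarrow> H \<inter> V1 \<in> X1 \<Longrightarrow> f2 P \<inter> V1 \<in> X1"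
    by blast+

  interpret split_family V1 V2 F f1 f2 X1 X2
  proof unfold_locales
    show "H \<inter> V1 \<subseteq> H' \<or> H \<inter> V2 \<subseteq> H'"
      if "H \<in> F" "H' \<in> F" "H \<inter> (V1 \<inter> V2) \<subseteq> H'" for H H'
    proof -
      have "H - H' \<subseteq> V1 \<or> H - H' \<subseteq> V2"
        using F(1) that by (intro connected_in_one_side[OF F(3)[OF that(1,2)] _ _ b1(3) b2(3)]) blast+
      then show ?thesis
        using that(3) by blast
    qed
    show "H \<inter> V1 = {} \<or> H \<inter> V2 = {}" if "H \<in> F" "H \<inter> (V1 \<inter> V2) = {}" for H
    proof -
      have "H \<subseteq> V1 \<or> H \<subseteq> V2"
        using F(1) that by (intro connected_in_one_side[OF F(2)[OF that(1)] _ _ b1(3) b2(3)]) blast+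
      then show ?thesis
        using that(2) by blast
    qed
    show "\<exists>Z\<in>X1. Z \<inter> (V1 \<inter> V2) = P \<inter> (V1 \<inter> V2)" if "P \<in> ?F1" for P
    proof -
      obtain Z where "Z \<in> X1" "Z \<inter> X = P \<inter> X"
        using a1(3) \<open>P \<in> ?F1\<close> by blast
      then show ?thesis
        using sep by (intro bexI[of _ Z]) blast+
    qed
    show "\<exists>Z\<in>X2. Z \<inter> (V1 \<inter> V2) = P \<inter> (V1 \<inter> V2)" if "P \<in> ?F2" for P
    proof -
      obtain Z where "Z \<in> X2" "Z \<inter> Y = P \<inter> Y"
        using a2(3) \<open>P \<in> ?F2\<close> by blast
      then show ?thesis
        using sep by (intro bexI[of _ Z]) blast+
    qed
    show "H \<subseteq> V1 \<union> V2" if "H \<in> F" for H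
      using F(1) that by blast
  qed (fact finF F(4) f1 f2 X1 X2)+
  interpret swap: split_family V2 V1 F f2 f1 X2 X1
    by (rule swapped)

  \<comment> \<open>The root bag \<open>Z\<close> and the joining bag \<open>W\<close>\<close>
  let ?tr = "\<lambda>H. H \<inter> X"
  define Y1 Y2 M1 M2 where Y1_def: "Y1 = f1 ` X1" and Y2_def: "Y2 = f2 ` X2"
    and M1_def: "M1 = f1 ` ?F1" and M2_def: "M2 = f2 ` ?F2"
  note defs = Y1_def Y2_def M1_def M2_def
  \<comment> \<open>These are the traces on \<open>X\<close> missing from \<open>Y1\<close>. Their
    representatives are taken from \<open>Y2\<close> where possible, to control how \<open>Z\<close>
    meets \<open>M2\<close>.\<close>
  define \<Sigma> where "\<Sigma> = ?tr ` F - ?tr ` Y1"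
  have \<Sigma>F: "\<Sigma> \<subseteq> ?tr ` F"
    unfolding \<Sigma>_def by blast
  from preferred_section[OF \<Sigma>F, of "\<lambda>H. H \<in> Y2"]
  obtain g where "(\<forall>\<sigma>\<in>\<Sigma>. g \<sigma> \<in> F \<and> ?tr (g \<sigma>) = \<sigma>) \<and>
      (\<forall>\<sigma>\<in>\<Sigma>. \<forall>H\<in>F. ?tr H = \<sigma> \<longrightarrow> H \<in> Y2 \<longrightarrow> g \<sigma> \<in> Y2)" ..
  then have g: "\<And>\<sigma>. \<sigma> \<in> \<Sigma> \<Longrightarrow> g \<sigma> \<in> F \<and> ?tr (g \<sigma>) = \<sigma>"
      "\<And>\<sigma> H. \<sigma> \<in> \<Sigma> \<Longrightarrow> H \<in> F \<Longrightarrow> ?tr H = \<sigma> \<Longrightarrow> H \<in> Y2 \<Longrightarrow> g \<sigma> \<in> Y2"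
    by simp_all
  define Z where "Z = Y1 \<union> g ` \<Sigma>"
  define W where "W = Z \<union> Y2"

  have YF: "Y1 \<subseteq> F" "Y2 \<subseteq> F" and MF: "M1 \<subseteq> F" "M2 \<subseteq> F"
    and YM: "Y1 \<subseteq> M1" "Y2 \<subseteq> M2"
    using X1 X2 f1 f2 unfolding defs by blast+
  have ZF: "Z \<subseteq> F" and WF: "W \<subseteq> F"
  proof -
    have "g ` \<Sigma> \<subseteq> F"
      by (rule image_subsetI) (simp add: g(1))
    then show "Z \<subseteq> F"
      using YF(1) unfolding Z_def by simp
    then show "W \<subseteq> F"
      using YF(2) unfolding W_def by simp
  qed
  have tr1: "?tr (f1 P) = ?tr P" if "P \<in> ?F1" for P
    using f1(1)[OF that] b1(2) by blast
  have injZ: "inj_on ?tr Z"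
  proof (rule inj_onI)
    fix H H'
    assume H: "H \<in> Z" "H' \<in> Z" "?tr H = ?tr H'"
    have 1: "P = P'" if "P \<in> X1" "P' \<in> X1" "?tr (f1 P) = ?tr (f1 P')" for P P'
      using inj_onD[OF a1(2)] that tr1 X1 by (metis subsetD)
    consider "H \<in> Y1" "H' \<in> Y1" | "?tr H \<in> \<Sigma>" "H = g (?tr H)" "H' = g (?tr H')"
    proof -
      have split: "h \<in> Y1 \<or> (?tr h \<in> \<Sigma> \<and> h = g (?tr h))" if "h \<in> Z" for h
        using that g(1) unfolding Z_def by auto
      have "?tr h \<notin> \<Sigma>" if "h \<in> Y1" for h
        using that unfolding \<Sigma>_def by blast
      then show thesis
        using that split[OF H(1)] split[OF H(2)] H(3) by metis
    qed
    then show "H = H'"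
    proof cases
      case 1
      then show ?thesis
        using \<open>\<And>P' P. \<lbrakk>P \<in> X1; P' \<in> X1; ?tr (f1 P) = ?tr (f1 P')\<rbrakk> \<Longrightarrow> P = P'\<close> H(3)
        unfolding Y1_def by blast
    qed (use H(3) in metis)
  qed
  have coverZ: "\<exists>H'\<in>Z. ?tr H' = ?tr H" if "H \<in> F" for H
  proof (cases "?tr H \<in> ?tr ` Y1")
    case True
    then show ?thesis
      unfolding Z_def by (metis (no_types, lifting) UnI1 imageE)
  next
    case False
    then have "?tr H \<in> \<Sigma>"
      using that unfolding \<Sigma>_def by simp
    then have "g (?tr H) \<in> Z" "?tr (g (?tr H)) = ?tr H"
      using g(1) unfolding Z_def by simp_all
    then show ?thesis
      by blast
  qed

  \<comment> \<open>Overlaps of the lifted families with \<open>W\<close>\<close>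
  have M12: "M1 \<inter> M2 \<subseteq> Y1 \<inter> Y2"
    using lifted_twice swap.lifted_twice unfolding defs by blast
  \<comment> \<open>Every trace on \<open>X\<close> occurring in \<open>M1\<close> already occurs in
    \<open>Y1\<close>, and \<Sigma> excludes those.\<close>
  have g1: "g \<sigma> \<notin> M1" if \<sigma>: "\<sigma> \<in> \<Sigma>" for \<sigma>
  proof
    assume "g \<sigma> \<in> M1"
    then obtain P where P: "P \<in> ?F1" "g \<sigma> = f1 P"
      unfolding M1_def by blast
    then obtain P' where P': "P' \<in> X1" "?tr P' = ?tr P"
      using a1(3) by blast
    have "?tr (f1 P') = \<sigma>"
      using P P' tr1[of P] tr1[of P'] X1 g(1)[OF \<sigma>] by auto
    then show False
      using \<sigma> P'(1) unfolding \<Sigma>_def Y1_def by blast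
  qed
  \<comment> \<open>The representative \<open>r\<close> in \<open>Y2\<close> agrees with
    \<open>g \<sigma>\<close> on \<open>V1\<close>, hence on \<open>X\<close>; so the preference for
    \<open>Y2\<close> takes effect.\<close>
  have g2: "g \<sigma> \<in> Y2" if \<sigma>: "\<sigma> \<in> \<Sigma>" and M: "g \<sigma> \<in> M2" for \<sigma>
  proof -
    obtain r where r: "r \<in> Y2" "r = g \<sigma> \<or> r \<inter> V1 = g \<sigma> \<inter> V1"
      using swap.lifted_representative[OF M[unfolded M2_def]] unfolding Y2_def by blast
    then have "?tr r = ?tr (g \<sigma>)"
      using b1(2) by blast
    then show ?thesis
      using g(1)[OF \<sigma>] g(2)[OF \<sigma> _ _ r(1)] r(1) YF(2) by blast
  qed
  have MZ: "M1 \<inter> W \<subseteq> Y1" "M2 \<inter> W \<subseteq> Y2"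
  proof -
    have G: "M1 \<inter> g ` \<Sigma> = {}" "M2 \<inter> g ` \<Sigma> \<subseteq> Y2"
      using g1 g2 by auto
    obtain G' where G': "G' = g ` \<Sigma>"
      by simp
    have W_eq: "W = (Y1 \<union> G') \<union> Y2"
      unfolding W_def Z_def G' ..
    note G = G[folded G']
    show "M1 \<inter> W \<subseteq> Y1" "M2 \<inter> W \<subseteq> Y2"
      using M12 G YM unfolding W_eq by blast+
  qed

  have finW: "finite W" "finite Z"
    using WF ZF finF finite_subset by blast+
  have cardZ: "card Z \<le> 2 ^ n"
    using card_traces[OF injZ finXY(1) b1(5)] by blast
  have "finite X2 \<and> card X2 \<le> 2 ^ n"
    using card_traces[OF a2(2) finXY(2) b2(5)] by blast
  then have "card Y2 \<le> 2 ^ n"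
    using card_image_le[of X2 f2] unfolding Y2_def by linarith
  \<comment> \<open>\<open>Z\<close> and \<open>Y2\<close> contribute at most \<open>2 ^ n\<close>
    members each.\<close>
  then have cardW: "card W < k"
    using card_Un_le[of Z Y2] cardZ k unfolding W_def by simp

  \<comment> \<open>The combined clique tree\<close>
  have inj1: "inj_on f1 ?F1"
    by (rule inj_on_inverseI[of _ "\<lambda>H. H \<inter> V1"]) (simp add: f1(1))
  have inj2: "inj_on f2 ?F2"
    by (rule inj_on_inverseI[of _ "\<lambda>H. H \<inter> V2"]) (simp add: f2(1))
  let ?L = "F - (M1 \<union> M2 \<union> W)"
  let ?QW = "((pairs W \<union> (`) f1 ` Q1) \<union> (`) f2 ` Q2) \<union> (\<Union>H\<in>?L. pairs (insert H W))"
  have "rooted_clique_tree k (W \<union> M1) (pairs W \<union> (`) f1 ` Q1) W"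
  proof (rule rooted_clique_tree.glue)
    show "rooted_clique_tree k W (pairs W) W"
      using finW cardW by (intro rooted_clique_tree.bag) auto
    show "rooted_clique_tree k (M1) ((`) f1 ` Q1) Y1"
      unfolding defs by (rule rooted_clique_tree_image[OF a1(1) inj1])
    show "W \<inter> M1 \<subseteq> W \<inter> Y1"
      using MZ by blast
  qed
  then have "rooted_clique_tree k ((W \<union> M1) \<union> M2) ((pairs W \<union> (`) f1 ` Q1) \<union> (`) f2 ` Q2) W"
  proof (rule rooted_clique_tree.glue)
    show "rooted_clique_tree k (M2) ((`) f2 ` Q2) Y2"
      unfolding defs by (rule rooted_clique_tree_image[OF a2(1) inj2])
    show "(W \<union> M1) \<inter> M2 \<subseteq> W \<inter> Y2"
      using MZ M12 unfolding W_def by blast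
  qed
  then have "rooted_clique_tree k (((W \<union> M1) \<union> M2) \<union> ?L) ?QW W"
    using finF cardW by (intro rooted_clique_tree_add_leaves) auto
  moreover have "((W \<union> M1) \<union> M2) \<union> ?L = F"
    using WF MF by blast
  ultimately have tW: "rooted_clique_tree k F ?QW W"
    by simp
  \<comment> \<open>The tree is rerooted at \<open>Z\<close>, because \<open>W\<close> may contain
    several members with the same trace on \<open>X\<close>.\<close>
  have "rooted_clique_tree k (Z \<union> F) (pairs Z \<union> ?QW) Z"
  proof (rule rooted_clique_tree.glue[OF _ tW])
    show "rooted_clique_tree k Z (pairs Z) Z"
      using finW cardZ k by (intro rooted_clique_tree.bag) auto
    show "Z \<inter> F \<subseteq> Z \<inter> W"
      unfolding W_def by blast
  qed
  moreover have "pairs Z \<union> ?QW = ?QW" "Z \<union> F = F"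
    using pairs_mono[of Z W] ZF unfolding W_def by blast+
  ultimately have tZ: "rooted_clique_tree k F ?QW Z"
    by simp

  \<comment> \<open>Connectivity above cliques\<close>
  define Q where "Q = ?QW"
  have Q: "(`) f1 ` Q1 \<subseteq> Q" "(`) f2 ` Q2 \<subseteq> Q" "pairs W \<subseteq> Q"
    unfolding Q_def by blast+
  have Q': "pairs (insert H W) \<subseteq> Q" if "H \<in> F - (M1 \<union> M2)" for H
  proof (cases "H \<in> W")
    case True
    then show ?thesis
      using Q(3) by (simp add: insert_absorb)
  next
    case False
    then have "H \<in> ?L"
      using that by blast
    then show ?thesis
      unfolding Q_def by blast
  qed
  have YW: "Y1 \<subseteq> W" "Y2 \<subseteq> W"
    unfolding W_def Z_def by blast+
  have con: "connected_in Q {H \<in> F. S \<subseteq> H}"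
    if S: "S \<noteq> {}" "S \<subseteq> V1 \<union> V2" "pairs S \<subseteq> E1 \<union> E2" for S
  proof -
    have c1: "connected_in Q1 {P \<in> ?F1. A \<subseteq> P}" if "A \<noteq> {}" "A \<subseteq> V1 \<inter> V2" for A
      using a1(4) that pairs_mono[OF that(2)] sepE(1) by blast
    have c2: "connected_in Q2 {P \<in> ?F2. A \<subseteq> P}" if "A \<noteq> {}" "A \<subseteq> V1 \<inter> V2" for A
      using a2(4) that pairs_mono[OF that(2)] sepE(2) by blast
    consider "S \<subseteq> V1" "pairs S \<subseteq> E1" | "S \<subseteq> V2" "pairs S \<subseteq> E2"
      using clique_in_glued_graph[OF S(2,3) b1(3) b2(3) sepE] by blast
    then show ?thesis
    proof cases
      case 1
      then have c: "connected_in Q1 {P \<in> ?F1. S \<subseteq> P}"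
        using a1(4) S by blast
      show ?thesis
        by (rule above_clique_connected[OF Q _ YW[unfolded defs] S(1) 1(1) c])
          (fact Q'[unfolded defs] c2)+
    next
      case 2
      then have c: "connected_in Q2 {P \<in> ?F2. S \<subseteq> P}"
        using a2(4) S by blast
      show ?thesis
        by (rule swap.above_clique_connected[OF Q(2,1,3) _ YW(2,1)[unfolded defs] S(1) 2(1) c])
          (fact Q'[unfolded defs Un_commute[of "f1 ` ?F1"]] c1[unfolded Int_commute[of V1]])+
    qed
  qed
  have "antichain_support k (V1 \<union> V2) (E1 \<union> E2) X F Q Z"
    unfolding antichain_support_def using tZ[folded Q_def] injZ coverZ con by blast
  then show ?thesis
    by blast
qed

text \<open>The bag bound allows \<open>2 ^ n\<close> members for each of the two root bags joined
  in a gluing step, plus one for a leaf. The induction varies \<open>F\<close>, since each side is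
  applied to its maximal restrictions.\<close>

lemma antichain_support_exists:
  assumes "rooted_clique_tree n V E X"
    and "F \<subseteq> Pow V" "\<And>H. H \<in> F \<Longrightarrow> connected_in E H"
      "\<And>H H'. H \<in> F \<Longrightarrow> H' \<in> F \<Longrightarrow> connected_in E (H - H')"
      "\<And>H H'. H \<in> F \<Longrightarrow> H' \<in> F \<Longrightarrow> H \<subseteq> H' \<Longrightarrow> H = H'"
  shows "\<exists>Q Y. antichain_support (2 ^ (n + 1) + 1) V E X F Q Y"
  using assms
proof (induction arbitrary: F)
  case (bag X)
  \<comment> \<open>In a single bag, members are determined by their traces on it, so the complete
    graph on \<open>F\<close> fits into one bag.\<close>
  have inj: "inj_on (\<lambda>H. H \<inter> X) F"
    using bag.prems(1) by (intro inj_onI) (metis Int_absorb2 PowD subsetD)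
  then have "finite F \<and> card F \<le> 2 ^ n"
    using card_traces bag.hyps by blast
  then have "rooted_clique_tree (2 ^ (n + 1) + 1) F (pairs F) F"
    by (intro rooted_clique_tree.bag) auto
  moreover have "connected_in (pairs F) {H \<in> F. S \<subseteq> H}" for S
    by (intro connected_in_clique pairs_mono) blast
  ultimately have "antichain_support (2 ^ (n + 1) + 1) X (pairs X) X F (pairs F) F"
    unfolding antichain_support_def using inj by blast
  then show ?case
    by blast
next
  case (glue V1 E1 X V2 E2 Y)
  let ?F1 = "maximal_sets ((\<lambda>H. H \<inter> V1) ` F)" and ?F2 = "maximal_sets ((\<lambda>H. H \<inter> V2) ` F)"
  have b1: "finite V1" "X \<subseteq> V1" "E1 \<subseteq> pairs V1" "pairs X \<subseteq> E1" "card X \<le> n"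
    and b2: "finite V2" "Y \<subseteq> V2" "E2 \<subseteq> pairs V2" "pairs Y \<subseteq> E2" "card Y \<le> n"
    using glue.hyps rooted_clique_tree_basic by blast+
  have "V1 \<inter> V2 \<subseteq> X" "V2 \<inter> V1 \<subseteq> Y"
    using glue.hyps(3) by blast+
  then have sepE: "pairs (V1 \<inter> V2) \<subseteq> E1" "pairs (V2 \<inter> V1) \<subseteq> E2"
    using b1(4) b2(4) pairs_mono by blast+
  have restrict1: "connected_in E1 (P \<inter> V1)" if "connected_in (E1 \<union> E2) P" for P
    by (rule connected_in_restrict[OF that b1(3) b2(3) sepE(1)])
  have restrict2: "connected_in E2 (P \<inter> V2)" if "connected_in (E1 \<union> E2) P" for P
    by (rule connected_in_restrict[OF _ b2(3) b1(3) sepE(2)]) (use that in \<open>simp add: Un_commute\<close>)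
  have sub1: "\<exists>H\<in>F. P = H \<inter> V1" if "P \<in> ?F1" for P
    using that by (auto simp: maximal_sets_def)
  have sub2: "\<exists>H\<in>F. P = H \<inter> V2" if "P \<in> ?F2" for P
    using that by (auto simp: maximal_sets_def)
  have "\<exists>Q Y. antichain_support (2 ^ (n + 1) + 1) V1 E1 X ?F1 Q Y"
  proof (rule glue.IH(1))
    show "?F1 \<subseteq> Pow V1"
      using sub1 by blast
    show "connected_in E1 P" if "P \<in> ?F1" for P
      using sub1[OF that] restrict1 glue.prems(2) by blast
    show "connected_in E1 (P - P')" if P: "P \<in> ?F1" "P' \<in> ?F1" for P P'
    proof -
      obtain H H' where H: "H \<in> F" "H' \<in> F" "P = H \<inter> V1" "P' = H' \<inter> V1"
        using sub1 P by meson
      then have "P - P' = (H - H') \<inter> V1"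
        by blast
      then show ?thesis
        using restrict1[OF glue.prems(3)] H by simp
    qed
  qed (fact maximal_sets_antichain)
  moreover have "\<exists>Q Z. antichain_support (2 ^ (n + 1) + 1) V2 E2 Y ?F2 Q Z"
  proof (rule glue.IH(2))
    show "?F2 \<subseteq> Pow V2"
      using sub2 by blast
    show "connected_in E2 P" if "P \<in> ?F2" for P
      using sub2[OF that] restrict2 glue.prems(2) by blast
    show "connected_in E2 (P - P')" if P: "P \<in> ?F2" "P' \<in> ?F2" for P P'
    proof -
      obtain H H' where H: "H \<in> F" "H' \<in> F" "P = H \<inter> V2" "P' = H' \<inter> V2"
        using sub2 P by meson
      then have "P - P' = (H - H') \<inter> V2"
        by blast
      then show ?thesis
        using restrict2[OF glue.prems(3)] H by simp
    qed
  qed (fact maximal_sets_antichain)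
  ultimately obtain Q1 X1 Q2 X2 where
    s: "antichain_support (2 ^ (n + 1) + 1) V1 E1 X ?F1 Q1 X1"
    "antichain_support (2 ^ (n + 1) + 1) V2 E2 Y ?F2 Q2 X2"
    by blast
  show ?case
    by (rule antichain_support_glue[OF glue.hyps _ _ _ _ s]) (simp_all add: glue.prems)
qed

section \<open>Tree decompositions and clique trees\<close>

text \<open>The first vertex of a longest path is a leaf: another neighbour would either extend the
  path or close a cycle with an initial segment of it.\<close>

lemma tree_has_leaf:
  assumes tree: "is_tree N T" and x: "x \<in> N" "y \<in> N" "x \<noteq> y"
  shows "\<exists>l\<in>N. \<exists>p\<in>N. p \<noteq> l \<and> {l, p} \<in> T \<and> (\<forall>q. {l, q} \<in> T \<longrightarrow> q = p)"
proof -
  have N: "finite N" "\<And>e. e \<in> T \<Longrightarrow> e \<subseteq> N \<and> card e = 2" "connected_in T N"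
    and acyc: "\<And>xs. \<not> is_cycle T xs"
    using tree by (auto simp: is_tree_def simple_graph_def)
  define path where "path xs \<longleftrightarrow> distinct xs \<and> set xs \<subseteq> N \<and>
    (\<forall>i. Suc i < length xs \<longrightarrow> {xs ! i, xs ! Suc i} \<in> T)" for xs
  have edge: "a \<in> N \<and> b \<in> N \<and> a \<noteq> b" if "{a, b} \<in> T" for a b
    using N(2)[OF that] by (auto simp: card_insert_if)
  have "(x, y) \<in> (adj_in T N)\<^sup>*"
    using N(3) x by (auto simp: connected_in_def)
  then obtain z where z: "{x, z} \<in> T"
    using x(3) by (auto elim: converse_rtranclE simp: adj_in_def)
  have p0: "path [x, z]"
    using edge[OF z] z by (auto simp: path_def)
  have bound: "length xs < Suc (card N)" if "path xs" for xs
    using that N(1) by (metis card_mono distinct_card le_imp_less_Suc path_def)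
  obtain xs where xs: "path xs" "\<And>ys. path ys \<Longrightarrow> length ys \<le> length xs"
    using ex_has_greatest_nat[of path "[x, z]" length "Suc (card N)"] p0 bound
      less_imp_le by blast
  then have len: "length xs \<ge> 2"
    using p0 by fastforce
  have d: "distinct xs" "set xs \<subseteq> N" "\<And>i. Suc i < length xs \<Longrightarrow> {xs ! i, xs ! Suc i} \<in> T"
    using xs(1) by (auto simp: path_def)
  have e01: "{xs ! 0, xs ! 1} \<in> T"
    using d(3)[of 0] len by simp
  have leaf: "q = xs ! 1" if q: "{xs ! 0, q} \<in> T" for q
  proof (rule ccontr)
    assume q1: "q \<noteq> xs ! 1"
    have q0: "q \<noteq> xs ! 0" "q \<in> N"
      using edge[OF q] by auto
    show False
    proof (cases "q \<in> set xs")
      case False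
      have "{(q # xs) ! i, (q # xs) ! Suc i} \<in> T" if "Suc i < length (q # xs)" for i
        using that d(3) q by (cases i) (auto simp: insert_commute)
      then have "path (q # xs)"
        using False d q0 by (simp add: path_def)
      then show False
        using xs(2) by fastforce
    next
      case True
      then obtain j where j: "j < length xs" "xs ! j = q"
        by (auto simp: in_set_conv_nth)
      have "j \<noteq> 0" "j \<noteq> 1"
        using j q0(1) q1 by metis+
      then have "j \<ge> 2"
        by simp
      \<comment> \<open>The segment from \<open>xs ! 0\<close> to \<open>xs ! j\<close> has at least
        three vertices because \<open>j \<ge> 2\<close>, as \<open>is_cycle\<close> demands.\<close>
      let ?c = "take (Suc j) xs"
      have "last ?c = q"
        using j by (simp add: take_Suc_conv_app_nth)
      have "hd ?c = xs ! 0"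
        using j by (subst hd_conv_nth) auto
      have "{q, xs ! 0} \<in> T"
        using q by (simp add: insert_commute)
      then have "is_cycle T ?c"
        unfolding is_cycle_def \<open>last ?c = q\<close> \<open>hd ?c = xs ! 0\<close>
        using j \<open>j \<ge> 2\<close> d(1,3) by simp
      then show False
        using acyc by blast
    qed
  qed
  show ?thesis
  proof (intro bexI conjI allI impI)
    show "q = xs ! 1" if "{xs ! 0, q} \<in> T" for q
      by (rule leaf[OF that])
  qed (use e01 edge[OF e01] in \<open>simp_all add: eq_commute\<close>)
qed

text \<open>A walk enters and leaves \<open>l\<close> only through \<open>p\<close>, so visits to
  \<open>l\<close> can be cut out; while at \<open>l\<close>, the invariant records that
  \<open>p\<close> has been reached.\<close>

lemma connected_in_remove_leaf:
  assumes con: "connected_in T S" and leaf: "\<And>q. {l, q} \<in> T \<Longrightarrow> q = p" and "p \<noteq> l"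
  shows "connected_in {e \<in> T. l \<notin> e} (S - {l})"
  unfolding connected_in_def
proof (intro ballI)
  fix x y
  assume x: "x \<in> S - {l}" and y: "y \<in> S - {l}"
  let ?R = "(adj_in {e \<in> T. l \<notin> e} (S - {l}))\<^sup>*"
  have "(z \<noteq> l \<longrightarrow> (x, z) \<in> ?R) \<and> (z = l \<longrightarrow> (x, p) \<in> ?R)"
    if "(x, z) \<in> (adj_in T S)\<^sup>*" for z
    using that
  proof (induction rule: rtrancl_induct)
    case (step z w)
    have zw: "z \<in> S" "w \<in> S" "{z, w} \<in> T" "{w, z} \<in> T"
      using step.hyps(2) by (auto simp: adj_in_def insert_commute)
    consider "z = l" | "z \<noteq> l" "w = l" | "z \<noteq> l" "w \<noteq> l"
      by blast
    then show ?case
    proof cases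
      case 1
      then show ?thesis
        using leaf zw step.IH \<open>p \<noteq> l\<close> by blast
    next
      case 2
      then show ?thesis
        using leaf zw step.IH by blast
    next
      case 3
      then have "(z, w) \<in> adj_in {e \<in> T. l \<notin> e} (S - {l})"
        using zw by (auto simp: adj_in_def)
      then show ?thesis
        using 3 step.IH by (meson rtrancl.rtrancl_into_rtrancl)
    qed
  qed (use x in auto)
  then show "(x, y) \<in> ?R"
    using con x y by (auto simp: connected_in_def)
qed

lemma is_cycle_mono: "is_cycle T xs \<Longrightarrow> T \<subseteq> T' \<Longrightarrow> is_cycle T' xs"
  by (auto simp: is_cycle_def)

lemma tree_remove_leaf:
  assumes tree: "is_tree N T" and l: "p \<in> N" "p \<noteq> l" "\<And>q. {l, q} \<in> T \<Longrightarrow> q = p"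
  shows "is_tree (N - {l}) {e \<in> T. l \<notin> e}"
  using assms connected_in_remove_leaf[of T N l p] is_cycle_mono[of "{e \<in> T. l \<notin> e}" _ T]
  unfolding is_tree_def simple_graph_def by blast

text \<open>On a cycle, \<open>l\<close> would have neighbours at two different positions, both
  equal to \<open>p\<close>. The end positions are separate cases because of the
  wrap-around.\<close>

lemma leaf_not_on_cycle:
  assumes cyc: "is_cycle T xs" and leaf: "\<And>q. {l, q} \<in> T \<Longrightarrow> q = p"
  shows "l \<notin> set xs"
proof
  assume "l \<in> set xs"
  then obtain i where i: "i < length xs" "xs ! i = l"
    by (auto simp: in_set_conv_nth)
  let ?n = "length xs"
  have n: "?n \<ge> 3" "distinct xs" "\<And>i. Suc i < ?n \<Longrightarrow> {xs ! i, xs ! Suc i} \<in> T"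
      "{xs ! (?n - 1), xs ! 0} \<in> T"
    using cyc by (auto simp: is_cycle_def last_conv_nth hd_conv_nth simp flip: length_greater_0_conv)
  have nb: "xs ! j = p" if "{xs ! i, xs ! j} \<in> T \<or> {xs ! j, xs ! i} \<in> T" for j
    using that i leaf by (auto simp: insert_commute)
  have eq: "j = k" if "j < ?n" "k < ?n" "xs ! j = p" "xs ! k = p" for j k
    using that n(2) nth_eq_iff_index_eq by metis
  consider "i = 0" | "i = ?n - 1" | "0 < i" "Suc i < ?n"
    using i by linarith
  then show False
  proof cases
    case 1
    then have "xs ! 1 = p" "xs ! (?n - 1) = p"
      using nb[of 1] nb[of "?n - 1"] n(3)[of 0] n(1,4) by auto
    then show False
      using eq[of 1 "?n - 1"] n(1) by linarith
  next
    case 2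
    then have "xs ! 0 = p" "xs ! (?n - 2) = p"
      using nb[of 0] nb[of "?n - 2"] n(3)[of "?n - 2"] n(1,4)
      by (auto simp: numeral_2_eq_2 Suc_diff_Suc)
    then show False
      using eq[of 0 "?n - 2"] n(1) by linarith
  next
    case 3
    then have "xs ! (i - 1) = p" "xs ! Suc i = p"
      using nb[of "i - 1"] nb[of "Suc i"] n(3)[of "i - 1"] n(3)[of i] by auto
    then show False
      using eq[of "i - 1" "Suc i"] 3 by linarith
  qed
qed

lemma tree_insert_leaf:
  assumes tree: "is_tree N T" and l: "l \<notin> N" "p \<in> N"
  shows "is_tree (insert l N) (insert {l, p} T)"
proof -
  have N: "finite N" "\<And>e. e \<in> T \<Longrightarrow> e \<subseteq> N \<and> card e = 2" "connected_in T N"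
    and acyc: "\<And>xs. \<not> is_cycle T xs"
    using tree by (auto simp: is_tree_def simple_graph_def)
  have "connected_in (insert {l, p} T) (insert l N)"
    using l connected_in_mono[OF N(3)] by (intro connected_in_insert[where p = p]) auto
  moreover have "\<not> is_cycle (insert {l, p} T) xs" for xs
  proof
    assume cyc: "is_cycle (insert {l, p} T) xs"
    have "q = p" if "{l, q} \<in> insert {l, p} T" for q
      using that N(2)[of "{l, q}"] l by (auto simp: doubleton_eq_iff)
    then have notl: "l \<notin> set xs"
      using leaf_not_on_cycle[OF cyc] by blast
    have e: "{a, b} \<in> T" if "{a, b} \<in> insert {l, p} T" "a \<in> set xs" "b \<in> set xs" for a b
      using that notl by (auto simp: doubleton_eq_iff)
    have "is_cycle T xs"
      unfolding is_cycle_def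
    proof (intro conjI allI impI)
      show "{xs ! i, xs ! Suc i} \<in> T" if "Suc i < length xs" for i
        using cyc that by (intro e) (auto simp: is_cycle_def)
      show "{last xs, hd xs} \<in> T"
        using cyc by (intro e hd_in_set last_in_set) (auto simp: is_cycle_def)
    qed (use cyc in \<open>auto simp: is_cycle_def\<close>)
    then show False
      using acyc by blast
  qed
  ultimately show ?thesis
    using N(1,2) l by (auto simp: is_tree_def simple_graph_def card_insert_if)
qed

text \<open>Remove a leaf \<open>l\<close> with neighbour \<open>p\<close>. A vertex shared by
  \<open>B l\<close> and another bag lies in \<open>B p\<close>, since its nodes are connected and
  the walk from \<open>l\<close> starts with \<open>p\<close>; so \<open>B l\<close> is attached
  along a clique.\<close>

lemma tree_bags_clique_tree:
  assumes "is_tree N T" "\<And>v. connected_in T {n \<in> N. v \<in> B n}"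
    and "\<And>n. n \<in> N \<Longrightarrow> finite (B n) \<and> card (B n) \<le> k"
  shows "\<exists>E. clique_tree k (\<Union>n\<in>N. B n) E \<and> (\<forall>n\<in>N. pairs (B n) \<subseteq> E)"
  using assms
proof (induction "card N" arbitrary: N T rule: less_induct)
  case less
  have N: "finite N" "N \<noteq> {}"
    using less.prems(1) by (auto simp: is_tree_def simple_graph_def)
  then obtain x where x: "x \<in> N"
    by blast
  show ?case
  proof (cases "N = {x}")
    case True
    then show ?thesis
      using less.prems(3)[OF x] clique_tree.bag[of "B x" k] by auto
  next
    case False
    then obtain y where y: "y \<in> N" "x \<noteq> y"
      using x by blast
    obtain l p where l: "l \<in> N" "p \<in> N" "p \<noteq> l" "\<forall>q. {l, q} \<in> T \<longrightarrow> q = p"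
      using tree_has_leaf[OF less.prems(1) x y] by blast
    let ?N = "N - {l}" and ?T = "{e \<in> T. l \<notin> e}"
    let ?V = "\<Union>n\<in>?N. B n"
    have eq: "{n \<in> ?N. v \<in> B n} = {n \<in> N. v \<in> B n} - {l}" for v
      by blast
    have "\<exists>E. clique_tree k ?V E \<and> (\<forall>n\<in>?N. pairs (B n) \<subseteq> E)"
    proof (rule less.hyps)
      show "card ?N < card N"
        using N(1) l(1) by (meson card_Diff1_less)
      show "is_tree ?N ?T"
        using tree_remove_leaf[OF less.prems(1) l(2,3)] l(4) by blast
      show "connected_in ?T {n \<in> ?N. v \<in> B n}" for v
        unfolding eq using connected_in_remove_leaf[OF less.prems(2) _ l(3)] l(4) by blast
    qed (use less.prems(3) in blast)
    then obtain E where E: "clique_tree k ?V E" "\<And>n. n \<in> ?N \<Longrightarrow> pairs (B n) \<subseteq> E"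
      by blast
    have "?V \<inter> B l \<subseteq> B p"
    proof
      fix v
      assume v: "v \<in> ?V \<inter> B l"
      then obtain n where n: "n \<in> N" "n \<noteq> l" "v \<in> B n"
        by blast
      then have "(l, n) \<in> (adj_in T {n \<in> N. v \<in> B n})\<^sup>*"
        using less.prems(2)[of v] l(1) v by (auto simp: connected_in_def)
      then obtain m where "(l, m) \<in> adj_in T {n \<in> N. v \<in> B n}"
        using n(2) by (auto elim: converse_rtranclE)
      then show "v \<in> B p"
        using l(4) by (auto simp: adj_in_def)
    qed
    then have "pairs (?V \<inter> B l) \<subseteq> E"
      using pairs_mono E(2)[of p] l by blast
    then have "clique_tree k (?V \<union> B l) (E \<union> pairs (B l))"
      using clique_tree.add_bag[OF E(1)] less.prems(3) l by blast
    moreover have "?V \<union> B l = (\<Union>n\<in>N. B n)"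
      using l(1) by blast
    moreover have "\<forall>n\<in>N. pairs (B n) \<subseteq> E \<union> pairs (B l)"
      using E(2) by blast
    ultimately show ?thesis
      by metis
  qed
qed

lemma single_bag_tree_decomposition:
  "E \<subseteq> pairs V \<Longrightarrow> tree_decomposition V E {0} {} (\<lambda>_. V)"
  by (auto simp: tree_decomposition_def is_tree_def simple_graph_def connected_in_def
      is_cycle_def pairs_def)

text \<open>The clause that every clique fits into some bag strengthens the induction: it yields the
  node \<open>p\<close> to which the next bag is attached.\<close>

lemma clique_tree_decomposition:
  assumes "clique_tree k V E"
  shows "\<exists>N T B. tree_decomposition V E N T B \<and> (\<forall>n\<in>N. card (B n) \<le> k) \<and>
    (\<forall>S. S \<subseteq> V \<longrightarrow> pairs S \<subseteq> E \<longrightarrow> (\<exists>n\<in>N. S \<subseteq> B n))"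
  using assms
proof induction
  case (bag X)
  then have "tree_decomposition X (pairs X) {0} {} (\<lambda>_. X) \<and> (\<forall>n\<in>{0::nat}. card X \<le> k) \<and>
    (\<forall>S. S \<subseteq> X \<longrightarrow> pairs S \<subseteq> pairs X \<longrightarrow> (\<exists>n\<in>{0::nat}. S \<subseteq> X))"
    using single_bag_tree_decomposition[of "pairs X" X] by simp
  then show ?case
    by blast
next
  case (add_bag V E Y)
  then obtain N T B where td: "tree_decomposition V E N T B" "\<forall>n\<in>N. card (B n) \<le> k"
    and hel: "\<And>S. S \<subseteq> V \<Longrightarrow> pairs S \<subseteq> E \<Longrightarrow> \<exists>n\<in>N. S \<subseteq> B n"
    by blast
  have tree: "is_tree N T" and sub: "\<And>n. n \<in> N \<Longrightarrow> B n \<subseteq> V"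
    and cov: "\<And>v. v \<in> V \<Longrightarrow> \<exists>n\<in>N. v \<in> B n" "\<And>e. e \<in> E \<Longrightarrow> \<exists>n\<in>N. e \<subseteq> B n"
    and con: "\<And>v. v \<in> V \<Longrightarrow> connected_in T {n \<in> N. v \<in> B n}"
    using td(1) by (auto simp: tree_decomposition_def)
  obtain l :: nat where l: "l \<notin> N"
    using tree ex_new_if_finite[OF infinite_UNIV_nat, of N]
    unfolding is_tree_def simple_graph_def by blast
  obtain p where p: "p \<in> N" "V \<inter> Y \<subseteq> B p"
    using hel[of "V \<inter> Y"] add_bag.hyps by blast
  let ?N = "insert l N" and ?T = "insert {l, p} T" and ?B = "B(l := Y)"
  have old: "?B n = B n" if "n \<in> N" for n
    using that l by auto
  have bag_old: "\<exists>n\<in>?N. S \<subseteq> ?B n" if "\<exists>n\<in>N. S \<subseteq> B n" for S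
    using that old by (metis insertCI)
  have bag_new: "\<exists>n\<in>?N. S \<subseteq> ?B n" if "S \<subseteq> Y" for S
    using that by (intro bexI[of _ l]) auto
  have con': "connected_in ?T {n \<in> ?N. v \<in> ?B n}" if "v \<in> V \<union> Y" for v
  proof (cases "v \<in> Y")
    case False
    then have "{n \<in> ?N. v \<in> ?B n} = {n \<in> N. v \<in> B n}"
      using l by auto
    then show ?thesis
      using connected_in_mono[OF con[of v], of ?T] False that by auto
  next
    case vY: True
    then have eq: "{n \<in> ?N. v \<in> ?B n} = insert l {n \<in> N. v \<in> B n}"
      using l by auto
    show ?thesis
    proof (cases "v \<in> V")
      case True
      then show ?thesis
        unfolding eq using p vY connected_in_mono[OF con[OF True], of ?T]
        by (intro connected_in_insert[where p = p]) auto
    next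
      case False
      then have "insert l {n \<in> N. v \<in> B n} = {l}"
        using sub by blast
      then show ?thesis
        unfolding eq by (metis connected_in_def rtrancl.rtrancl_refl singletonD)
    qed
  qed
  have bas: "finite V \<and> E \<subseteq> pairs V"
    using add_bag.hyps(1) clique_tree_basic by blast
  have "tree_decomposition (V \<union> Y) (E \<union> pairs Y) ?N ?T ?B"
    unfolding tree_decomposition_def
  proof (intro conjI ballI)
    show "is_tree ?N ?T"
      by (rule tree_insert_leaf[OF tree l p(1)])
    show "?B n \<subseteq> V \<union> Y" if "n \<in> ?N" for n
      using that sub by auto
    show "\<exists>n\<in>?N. v \<in> ?B n" if "v \<in> V \<union> Y" for v
      using that bag_old[of "{v}"] bag_new[of "{v}"] cov(1)[of v] by blast
    show "\<exists>n\<in>?N. e \<subseteq> ?B n" if "e \<in> E \<union> pairs Y" for e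
      using that bag_old[of e] bag_new[of e] cov(2)[of e] unfolding pairs_def by blast
  qed (rule con')
  moreover have "\<forall>n\<in>?N. card (?B n) \<le> k"
    using td(2) add_bag.hyps by auto
  moreover have "\<exists>n\<in>?N. S \<subseteq> ?B n" if S: "S \<subseteq> V \<union> Y" "pairs S \<subseteq> E \<union> pairs Y" for S
  proof -
    have "(S \<subseteq> V \<and> pairs S \<subseteq> E) \<or> (S \<subseteq> Y \<and> pairs S \<subseteq> pairs Y)"
      using clique_in_glued_graph[OF S, of] bas add_bag.hyps(4) pairs_mono[of "V \<inter> Y" Y] by blast
    then show ?thesis
      using hel[of S] bag_old[of S] bag_new[of S] by blast
  qed
  ultimately show ?case
    by blast
qed

text \<open>Each \<open>h\<close> is attached by a two-element bag \<open>{h, d h}\<close>, which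
  meets the rest only in \<open>d h\<close>.\<close>

lemma clique_tree_add_leaves:
  assumes "finite R" "clique_tree k V E" "R \<inter> V = {}" "d ` R \<subseteq> V" "2 \<le> k"
  shows "\<exists>E'. clique_tree k (V \<union> R) E' \<and> E \<subseteq> E' \<and> (\<forall>h\<in>R. {h, d h} \<in> E')"
  using assms
proof (induction R)
  case empty
  then show ?case
    by auto
next
  case (insert h R)
  then obtain E' where E': "clique_tree k (V \<union> R) E'" "E \<subseteq> E'" "\<forall>h\<in>R. {h, d h} \<in> E'"
    by auto
  have h: "h \<noteq> d h" "(V \<union> R) \<inter> {h, d h} = {d h}"
    using insert by auto
  have "clique_tree k ((V \<union> R) \<union> {h, d h}) (E' \<union> pairs {h, d h})"
    using E'(1) insert.prems(4) h
    by (intro clique_tree.add_bag) (auto simp: pairs_subset_iff)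
  moreover have "(V \<union> R) \<union> {h, d h} = V \<union> insert h R"
    using insert.prems by auto
  moreover have "{h, d h} \<in> pairs {h, d h}"
    using h by (simp add: pair_in_pairs)
  ultimately show ?case
    using E' by (intro exI[of _ "E' \<union> pairs {h, d h}"]) auto
qed

theorem mainTheorem2:
  fixes V :: "'a set" and E :: "'a set set" and \<H> :: "'a set set" and t :: nat
  assumes "simple_graph V E"
    and "treewidth V E = t"
    and "non_piercing V E \<H>"
  shows "\<exists>Q. dual_support V \<H> Q \<and> treewidth \<H> Q \<le> 2 ^ (4 * (t + 1))"
proof -
  have V: "finite V" "E \<subseteq> pairs V"
    using assms(1) by (auto simp: simple_graph_def pairs_def)
  have "\<exists>N T B. tree_decomposition V E N T B \<and> (\<forall>n\<in>N. card (B n) \<le> treewidth V E + 1)"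
    unfolding treewidth_def
  \<comment> \<open>The one-bag decomposition shows that some width is attained, so the least one is
    too.\<close>
  proof (rule LeastI_ex)
    show "\<exists>k N T B. tree_decomposition V E N T B \<and> (\<forall>n\<in>N. card (B n) \<le> k + 1)"
      using single_bag_tree_decomposition[OF V(2)] le_add1 by blast
  qed
  then obtain N T B where td: "tree_decomposition V E N T B"
    and card: "\<And>n. n \<in> N \<Longrightarrow> card (B n) \<le> t + 1"
    using assms(2) by blast
  have tree: "is_tree N T" and sub: "\<And>n. n \<in> N \<Longrightarrow> B n \<subseteq> V"
    and cov: "\<And>v. v \<in> V \<Longrightarrow> \<exists>n\<in>N. v \<in> B n" "\<And>e. e \<in> E \<Longrightarrow> \<exists>n\<in>N. e \<subseteq> B n"
    and con: "\<And>v. v \<in> V \<Longrightarrow> connected_in T {n \<in> N. v \<in> B n}"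
    using td by (auto simp: tree_decomposition_def)
  have "connected_in T {n \<in> N. v \<in> B n}" for v
  proof (cases "v \<in> V")
    case False
    then show ?thesis
      using sub unfolding connected_in_def by blast
  qed (rule con)
  then obtain E' where "clique_tree (t + 1) (\<Union>n\<in>N. B n) E'"
    and E'B: "\<And>n. n \<in> N \<Longrightarrow> pairs (B n) \<subseteq> E'"
    using tree_bags_clique_tree[OF tree, of B "t + 1"] card sub V(1) finite_subset by metis
  moreover have "(\<Union>n\<in>N. B n) = V"
    using sub cov(1) by blast
  ultimately obtain X where rt: "rooted_clique_tree (t + 1) V E' X"
    using clique_tree_imp_rooted by metis
  have EE': "E \<subseteq> E'"
  proof
    fix e
    assume e: "e \<in> E"
    then obtain n where "n \<in> N" "e \<in> pairs (B n)"
      using cov(2)[OF e] V(2) unfolding pairs_def by blast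
    then show "e \<in> E'"
      using E'B by blast
  qed
  \<comment> \<open>Completing the bags only adds edges, so all required connectivity survives in
    \<open>E'\<close>.\<close>
  have np: "\<And>H. H \<in> \<H> \<Longrightarrow> H \<subseteq> V" "\<And>H. H \<in> \<H> \<Longrightarrow> connected_in E' H"
      "\<And>H H'. H \<in> \<H> \<Longrightarrow> H' \<in> \<H> \<Longrightarrow> connected_in E' (H - H')"
    using assms(3) connected_in_mono[OF _ EE'] by (auto simp: non_piercing_def)
  have fin: "finite \<H>"
    using np(1) V(1) finite_subset[of \<H> "Pow V"] by blast
  define F where "F = maximal_sets \<H>"
  have F\<H>: "F \<subseteq> \<H>"
    unfolding F_def maximal_sets_def by blast
  let ?K = "2 ^ (t + 1 + 1) + 1"
  have "\<exists>Q Y. antichain_support ?K V E' X F Q Y"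
  proof (rule antichain_support_exists[OF rt])
    show "F \<subseteq> Pow V"
      using F\<H> np(1) by blast
    show "H = H'" if "H \<in> F" "H' \<in> F" "H \<subseteq> H'" for H H'
      using that maximal_sets_antichain unfolding F_def by blast
  qed (use F\<H> np in blast)+
  then obtain Q Y where Q: "rooted_clique_tree ?K F Q Y"
    and conQ: "\<And>S. S \<noteq> {} \<Longrightarrow> S \<subseteq> V \<Longrightarrow> pairs S \<subseteq> E' \<Longrightarrow> connected_in Q {H \<in> F. S \<subseteq> H}"
    unfolding antichain_support_def by blast
  have "\<forall>H\<in>\<H>. \<exists>D. D \<in> F \<and> H \<subseteq> D"
    using maximal_sets_above[OF fin] unfolding F_def by blast
  then obtain d where d: "\<forall>H\<in>\<H>. d H \<in> F \<and> H \<subseteq> d H"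
    by (rule bchoice[THEN exE])
  have "\<exists>Q'. clique_tree ?K (F \<union> (\<H> - F)) Q' \<and> Q \<subseteq> Q' \<and> (\<forall>H\<in>\<H> - F. {H, d H} \<in> Q')"
  proof (rule clique_tree_add_leaves)
    show "d ` (\<H> - F) \<subseteq> F"
      using d by auto
    show "clique_tree ?K F Q"
      by (rule rooted_imp_clique_tree[OF Q])
  qed (use fin in auto)
  moreover have "F \<union> (\<H> - F) = \<H>"
    using F\<H> by blast
  ultimately obtain Q' where ct: "clique_tree ?K \<H> Q'" and QQ': "Q \<subseteq> Q'"
    and att: "\<And>H. H \<in> \<H> - F \<Longrightarrow> {H, d H} \<in> Q'"
    by metis
  have "connected_in Q' {H \<in> \<H>. v \<in> H}" if v: "v \<in> V" for v
  proof (rule connected_in_attach)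
    have "connected_in Q {H \<in> F. {v} \<subseteq> H}"
      using v by (intro conQ) (auto simp: pairs_subset_iff)
    then show "connected_in Q' {H \<in> F. v \<in> H}"
      using connected_in_mono[OF _ QQ'] by simp
    show "{H \<in> F. v \<in> H} \<subseteq> {H \<in> \<H>. v \<in> H}"
      using F\<H> by blast
    fix H
    assume H: "H \<in> {H \<in> \<H>. v \<in> H}"
    show "\<exists>c\<in>{H \<in> F. v \<in> H}. (H, c) \<in> (adj_in Q' {H \<in> \<H>. v \<in> H})\<^sup>*"
    proof (cases "H \<in> F")
      case False
      have D: "d H \<in> F" "v \<in> d H"
        using d H by auto
      \<comment> \<open>As \<open>H \<subseteq> d H\<close>, every vertex of \<open>H\<close> also
        lies in \<open>d H\<close>, so this one edge suffices for all vertices of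
        \<open>H\<close>.\<close>
      have "(H, d H) \<in> adj_in Q' {H \<in> \<H>. v \<in> H}"
        using D H F\<H> att[of H] False by (auto simp: adj_in_def)
      then show ?thesis
        using D by blast
    qed (use H in blast)
  qed
  moreover have "simple_graph \<H> Q'"
    using clique_tree_basic[OF ct] by (auto simp: simple_graph_def pairs_def)
  ultimately have ds: "dual_support V \<H> Q'"
    by (simp add: dual_support_def)
  have "\<exists>N T B. tree_decomposition \<H> Q' N T B \<and> (\<forall>n\<in>N. card (B n) \<le> 2 ^ (t + 1 + 1) + 1)"
    using clique_tree_decomposition[OF ct] by blast
  \<comment> \<open>Treewidth is bag size minus one, which absorbs the extra \<open>+ 1\<close> of
    \<open>?K\<close>.\<close>
  then have "treewidth \<H> Q' \<le> 2 ^ (t + 1 + 1)"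
    unfolding treewidth_def by (rule Least_le)
  also have "(2::nat) ^ (t + 1 + 1) \<le> 2 ^ (4 * (t + 1))"
    by (rule power_increasing) auto
  finally show ?thesis
    using ds by blast
qed

end
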